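(* Let $1/2<s\le 1$, let $u_0$ be smooth and $2\pi$-periodic, and let $u^{N}$ be the solution of the semidiscrete problem $\frac{d}{dt}u^{N}=F(u^{N})$, $0\le t\le T$, $u^{N}(0)=P_Nu_0$. With $I_1=I_1(u^N(0))$, $E=H(u^N(0))$ and $C_\infty=\big(\sum_{k=-\infty}^{\infty}\frac{1}{1+|k|^{2s}}\big)^{1/2}$, assume that $$C_*:=1-C_\infty^2I_1>0,\qquad \frac{I_1}{2}+E\ge 0 .$$ Assume that the solution $u$ of the periodic problem $iu_t-(-\partial_{xx})^su+|u|^2u=0$, $u(x,0)=u_0(x)$, is in $H^{\mu}$, $\mu>s$, for $t\in[0,T]$, with $\sup_{0\le t\le T}\|u(t)\|_\mu<\infty$. Then $$\max_{0\le t\le T}\|u^{N}(t)-u(t)\|_{s}\lesssim N^{s-\mu},$$ with implied constant independent of $N$.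
   Context: $T>0$ is fixed. All functions are complex-valued and $2\pi$-periodic in $x$; $L^2=L^2(-\pi,\pi)$ with $(u_1,u_2)=\int_{-\pi}^{\pi}u_1\overline{u_2}\,dx$. $\widehat u(k)=\frac1{2\pi}\int_{-\pi}^{\pi}u(x)e^{-ikx}dx$. For $\mu\ge0$, $H^\mu$ is the periodic Sobolev space with norm $\|u\|_\mu=(\sum_{k\in\mathbb Z}(1+k^2)^\mu|\widehat u(k)|^2)^{1/2}$. $(-\partial_{xx})^{s}$ is the Fourier multiplier with symbol $|k|^{2s}$, $|D|^s=(-\partial_{xx})^{s/2}$. $N\ge1$ is an integer, $S_N=\mathrm{span}\{e^{ikx}:-N\le k\le N\}$, $P_Nu=\sum_{|k|\le N}\widehat u(k)e^{ikx}$. $F:S_N\to S_N$ is $F(u)=-i(-\partial_{xx})^su+iP_N(|u|^2u)$, so that $u^N:[0,T]\to S_N$ satisfies $(iu^N_t-(-\partial_{xx})^su^N+|u^N|^2u^N,\varphi)=0$ for all $\varphi\in S_N$. $I_1(u)=\frac12\int_{-\pi}^{\pi}|u|^2dx$, $H(u)=\frac12\int_{-\pi}^{\pi}\big(||D|^su|^2-\frac12|u|^4\big)dx$. $g_1\lesssim g_2$ means $g_1\le Cg_2$ for some constant $C$. *)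

theory Defs
  imports "HOL-Analysis.Analysis"
begin

abbreviation circ :: "real measure" where
  "circ \<equiv> lebesgue_on {-pi..pi}"

definition periodic :: "(real \<Rightarrow> complex) \<Rightarrow> bool" where
  "periodic u \<longleftrightarrow> (\<forall>x. u (x + 2 * pi) = u x)"

definition smooth_periodic :: "(real \<Rightarrow> complex) \<Rightarrow> bool" where
  "smooth_periodic u \<longleftrightarrow> periodic u \<and>
     (\<forall>n x. ((\<lambda>g y. vector_derivative g (at y)) ^^ n) u differentiable (at x))"

text \<open>Elements of \<open>L\<^sup>2\<close> are represented by \<open>2\<pi>\<close>-periodic functions; Fourier
  coefficients, integrals and Sobolev norms depend only on the class modulo null sets.\<close>

definition L2_per :: "(real \<Rightarrow> complex) set" where
  "L2_per = {u. periodic u \<and> u \<in> borel_measurable circ \<and> integrable circ (\<lambda>x. (cmod (u x))\<^sup>2)}"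

definition L2_inner :: "(real \<Rightarrow> complex) \<Rightarrow> (real \<Rightarrow> complex) \<Rightarrow> complex" where
  "L2_inner u v = (LINT x|circ. u x * cnj (v x))"

definition fourier_coeff :: "(real \<Rightarrow> complex) \<Rightarrow> int \<Rightarrow> complex" where
  "fourier_coeff u k = (LINT x|circ. u x * cis (- (of_int k * x))) / (2 * pi)"

definition sobolev_space :: "real \<Rightarrow> (real \<Rightarrow> complex) set" where
  "sobolev_space \<mu> = {u \<in> L2_per.
     (\<lambda>k::int. (1 + (of_int k)\<^sup>2) powr \<mu> * (cmod (fourier_coeff u k))\<^sup>2) summable_on UNIV}"

definition sobolev_norm :: "real \<Rightarrow> (real \<Rightarrow> complex) \<Rightarrow> real" where
  "sobolev_norm \<mu> u =
     sqrt (\<Sum>\<^sub>\<infinity>k::int. (1 + (of_int k)\<^sup>2) powr \<mu> * (cmod (fourier_coeff u k))\<^sup>2)"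

text \<open>The fractional operators are used only on trigonometric polynomials and on smooth periodic
  functions, where the Fourier series below converges absolutely at every point.\<close>

definition frac_lap :: "real \<Rightarrow> (real \<Rightarrow> complex) \<Rightarrow> real \<Rightarrow> complex" where
  "frac_lap s u x =
     (\<Sum>\<^sub>\<infinity>k::int. of_real (\<bar>of_int k\<bar> powr (2 * s)) * fourier_coeff u k * cis (of_int k * x))"

definition abs_D :: "real \<Rightarrow> (real \<Rightarrow> complex) \<Rightarrow> real \<Rightarrow> complex" where
  "abs_D s = frac_lap (s / 2)"

definition trig_space :: "nat \<Rightarrow> (real \<Rightarrow> complex) set" where
  "trig_space N = {u. \<exists>c. u = (\<lambda>x. \<Sum>k\<in>{- int N..int N}. c k * cis (of_int k * x))}"

definition trig_proj :: "nat \<Rightarrow> (real \<Rightarrow> complex) \<Rightarrow> real \<Rightarrow> complex" where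
  "trig_proj N u x = (\<Sum>k\<in>{- int N..int N}. fourier_coeff u k * cis (of_int k * x))"

definition cubic :: "(real \<Rightarrow> complex) \<Rightarrow> real \<Rightarrow> complex" where
  "cubic u x = of_real ((cmod (u x))\<^sup>2) * u x"

definition galerkin_rhs :: "real \<Rightarrow> nat \<Rightarrow> (real \<Rightarrow> complex) \<Rightarrow> real \<Rightarrow> complex" where
  "galerkin_rhs s N u x = - \<i> * frac_lap s u x + \<i> * trig_proj N (cubic u) x"

definition mass :: "(real \<Rightarrow> complex) \<Rightarrow> real" where
  "mass u = 1 / 2 * (LINT x|circ. (cmod (u x))\<^sup>2)"

definition hamiltonian :: "real \<Rightarrow> (real \<Rightarrow> complex) \<Rightarrow> real" where
  "hamiltonian s u =
     1 / 2 * (LINT x|circ. (cmod (abs_D s u x))\<^sup>2 - 1 / 2 * cmod (u x) ^ 4)"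

definition C_infty :: "real \<Rightarrow> real" where
  "C_infty s = sqrt (\<Sum>\<^sub>\<infinity>k::int. 1 / (1 + \<bar>of_int k\<bar> powr (2 * s)))"

text \<open>Since \<open>trig_space N\<close> is finite dimensional, differentiability in time is the same as
  differentiability at every point \<open>x\<close>.\<close>

definition semidiscrete_solution ::
    "real \<Rightarrow> real \<Rightarrow> nat \<Rightarrow> (real \<Rightarrow> complex) \<Rightarrow> (real \<Rightarrow> real \<Rightarrow> complex) \<Rightarrow> bool" where
  "semidiscrete_solution T s N u\<^sub>0 v \<longleftrightarrow>
     v 0 = trig_proj N u\<^sub>0 \<and>
     (\<forall>t\<in>{0..T}. v t \<in> trig_space N \<and>
        (\<forall>x. ((\<lambda>\<tau>. v \<tau> x) has_vector_derivative galerkin_rhs s N (v t) x) (at t within {0..T})))"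

text \<open>The equation \<open>i u\<^sub>t - (-\<partial>\<^sub>x\<^sub>x)\<^sup>s u + |u|\<^sup>2 u = 0\<close> is understood in the sense of periodic
  distributions in \<open>x\<close>, so that no regularity of \<open>u\<close> is built in beyond what gives the pairings a
  meaning (\<open>u t \<in> L\<^sup>3\<close>, which follows from \<open>u t \<in> sobolev_space \<mu>\<close> with \<open>\<mu> > 1/2\<close>).  The self-adjoint
  operator falls on the test function without a conjugate because its symbol is real.\<close>

definition fnls_solution ::
    "real \<Rightarrow> real \<Rightarrow> (real \<Rightarrow> complex) \<Rightarrow> (real \<Rightarrow> real \<Rightarrow> complex) \<Rightarrow> bool" where
  "fnls_solution T s u\<^sub>0 u \<longleftrightarrow>
     (AE x in circ. u 0 x = u\<^sub>0 x) \<and>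
     (\<forall>\<phi>. smooth_periodic \<phi> \<longrightarrow> (\<forall>t\<in>{0..T}. \<exists>d.
        ((\<lambda>\<tau>. L2_inner (u \<tau>) \<phi>) has_vector_derivative d) (at t within {0..T}) \<and>
        \<i> * d - L2_inner (u t) (frac_lap s \<phi>) + L2_inner (cubic (u t)) \<phi> = 0))"

end

theory Submission
  imports Defs
begin

text \<open>Passing to Fourier coefficients turns both equations into ordinary differential equations for
  sequences.  The sequences square summable against \<open>(1 + k\<^sup>2) powr s\<close> form a convolution algebra for
  \<open>1 / 2 < s \<le> 1\<close>, so the cubic term is locally Lipschitz, and the weighted sum \<open>y\<close> of the squared
  coefficients of \<open>v - u\<close> with \<open>\<bar>k\<bar> \<le> N\<close> satisfies \<open>y' \<le> L * (y + D)\<close> as long as \<open>y \<le> 1\<close>, where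
  \<open>D\<close>, of order \<open>N powr (2 * (s - \<mu>))\<close>, bounds the contribution of the frequencies \<open>\<bar>k\<bar> > N\<close>.  As
  \<open>y\<close> vanishes initially, Gronwall's inequality keeps \<open>y\<close> below 1 when \<open>N\<close> is large and yields the
  rate.  For the finitely many remaining \<open>N\<close>, conservation of mass bounds \<open>v\<close>.\<close>

section \<open>Uniqueness of Fourier coefficients\<close>

text \<open>The solution \<open>u\<close> is given only as a distributional one, so what can be
  differentiated in time is each single Fourier coefficient, not a norm of the whole error. This is
  why the energy argument runs on a finite sum: for frequencies at most \<open>N\<close> in modulus,
  the coefficients of \<open>v\<close> and \<open>u\<close> obey equations of the same form and
  start from equal values. Subtracting them, the fractional Laplacian contributes a purely imaginary
  quantity and drops out, so no derivative is lost. The cubic term however couples all frequencies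
  and sees the full error. Its high part is just the tail of \<open>u\<close>, because
  \<open>v\<close> has none, and the surplus regularity \<open>\<mu> - s\<close> makes this tail
  small; it enters as a source term.

  Since \<open>u t\<close> is an \<open>L2\<close> class, its cubic can be turned into convolutions
  of coefficients only after identifying \<open>u t\<close> almost everywhere with its Fourier
  series. Hence the uniqueness theorem comes at the start.\<close>

inductive trig_poly :: "(real \<Rightarrow> complex) \<Rightarrow> bool" where
  monomial: "trig_poly (\<lambda>x. c * cis (of_int k * x))"
| add: "trig_poly p \<Longrightarrow> trig_poly q \<Longrightarrow> trig_poly (\<lambda>x. p x + q x)"

lemma trig_poly_mult:
  assumes "trig_poly p" "trig_poly q"
  shows "trig_poly (\<lambda>x. p x * q x)"
  using assms(1)
proof induction
  case (monomial c k)
  from assms(2) show ?case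
  proof induction
    case (monomial d l)
    have "(\<lambda>x. c * cis (of_int k * x) * (d * cis (of_int l * x))) =
      (\<lambda>x. (c * d) * cis (of_int (k + l) * x))"
      by (auto simp: cis_mult ring_distribs mult_ac simp flip: cis_mult)
    then show ?case
      using trig_poly.monomial[of "c * d" "k + l"] by simp
  next
    case (add p q)
    then show ?case
      using trig_poly.add by (fastforce simp: ring_distribs)
  qed
next
  case (add p q)
  then show ?case
    using trig_poly.add by (fastforce simp: ring_distribs)
qed

text \<open>Stone--Weierstrass supplies real polynomial functions of a complex variable. On the unit
  circle these are trigonometric polynomials: a linear functional becomes
  \<open>f 1 * cos x + f \<i> * sin x\<close>, which by Euler's formula has the frequencies 1 and -1
  only.\<close>

lemma trig_poly_real_polynomial_function:
  fixes f :: "complex \<Rightarrow> real"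
  assumes "real_polynomial_function f"
  shows "trig_poly (\<lambda>x. of_real (f (cis x)))"
  using assms
proof induction
  case (linear f)
  interpret bounded_linear f by fact
  define c d where "c = f 1" and "d = f \<i>"
  have "f (cis x) = cos x * c + sin x * d" for x
  proof -
    have "cis x = cos x *\<^sub>R 1 + sin x *\<^sub>R \<i>"
      by (auto simp: complex_eq_iff)
    then show ?thesis
      by (simp only: add scaleR c_def d_def) simp
  qed
  then have eq: "(\<lambda>x. complex_of_real (f (cis x))) = (\<lambda>x. (c - \<i> * d) / 2 * cis (of_int 1 * x) +
     (c + \<i> * d) / 2 * cis (of_int (- 1) * x))"
    by (auto simp: complex_eq_iff field_simps)
  show ?case
    unfolding eq by (intro trig_poly.intros)
next
  case (const c)
  then show ?case
    using trig_poly.monomial[of "of_real c" 0] by simp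
next
  case (add f g)
  then show ?case
    using trig_poly.add by fastforce
next
  case (mult f g)
  then show ?case
    using trig_poly_mult by fastforce
qed

lemma integrable_circ_mult_bounded:
  fixes f g :: "real \<Rightarrow> complex"
  assumes "integrable circ f" "g \<in> borel_measurable circ" "\<And>x. cmod (g x) \<le> B"
  shows "integrable circ (\<lambda>x. f x * g x)"
proof (rule Bochner_Integration.integrable_bound)
  show "integrable circ (\<lambda>x. B * cmod (f x))"
    using assms(1) by (intro integrable_mult_right integrable_norm)
  show "(\<lambda>x. f x * g x) \<in> borel_measurable circ"
    using assms(1,2) borel_measurable_integrable by (intro borel_measurable_times)
  have "cmod (f x) * cmod (g x) \<le> B * cmod (f x)" for x
    using mult_right_mono[OF assms(3), of "cmod (f x)"] by (simp add: mult.commute)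
  moreover have "B * cmod (f x) \<le> \<bar>B * cmod (f x)\<bar>" for x by simp
  ultimately show "AE x in circ. norm (f x * g x) \<le> norm (B * cmod (f x))"
    by (auto simp: norm_mult intro: order_trans)
qed

lemma measurable_circ_continuous:
  fixes f :: "real \<Rightarrow> 'a::euclidean_space"
  assumes "continuous_on UNIV f"
  shows "f \<in> borel_measurable circ"
  using assms by (meson continuous_imp_measurable_on_sets_lebesgue continuous_on_subset subset_UNIV
      lebesgue_on_mono lmeasurable_iff_integrable fmeasurableD lmeasurable_interval)

lemma measurable_circ_cis [measurable]: "(\<lambda>x. cis (a * x)) \<in> borel_measurable circ"
  by (intro measurable_circ_continuous continuous_intros)

lemma integrable_circ_mult_cis:
  assumes "integrable circ f"
  shows "integrable circ (\<lambda>x. f x * cis (a * x))"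
  by (rule integrable_circ_mult_bounded[OF assms, where B = 1]) auto

text \<open>Integrability belongs to the conclusion because the additive step of the induction needs
  it to split the integral.\<close>

lemma trig_poly_orthogonal:
  assumes g: "integrable circ g" "\<And>k. fourier_coeff g k = 0"
    and "trig_poly p"
  shows "integrable circ (\<lambda>x. g x * p x) \<and> (LINT x|circ. g x * p x) = 0"
  using assms(3)
proof induction
  case (monomial c k)
  have "(\<lambda>x. g x * (c * cis (of_int k * x))) = (\<lambda>x. c * (g x * cis (of_int k * x)))"
    by auto
  moreover have "integrable circ (\<lambda>x. c * (g x * cis (of_int k * x)))"
    by (intro integrable_mult_right integrable_circ_mult_cis g)
  moreover have "(LINT x|circ. g x * cis (of_int k * x)) = 0"
    using g(2)[of "- k"] by (simp add: fourier_coeff_def)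
  ultimately show ?case by simp
next
  case (add p q)
  then show ?case
    by (auto simp: ring_distribs)
qed

text \<open>Approximating \<open>f\<close> within \<open>e\<close> on the unit circle by a
  polynomial changes the integral by at most \<open>e\<close> times the \<open>L1\<close> norm of
  \<open>g\<close>, and the integral against the polynomial vanishes. Composing with
  \<open>cis\<close> builds periodicity in, so a function on the circle can be approximated without
  matching values at the endpoints.\<close>

lemma continuous_orthogonal:
  fixes f :: "complex \<Rightarrow> real"
  assumes g: "integrable circ g" "\<And>k. fourier_coeff g k = 0"
    and f: "continuous_on UNIV f"
  shows "(LINT x|circ. g x * of_real (f (cis x))) = 0"
proof -
  define I where "I = (LINT x|circ. cmod (g x))"
  have I: "I \<ge> 0" by (auto simp: I_def)
  have fm: "(\<lambda>x. complex_of_real (f (cis x))) \<in> borel_measurable circ"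
    by (intro measurable_circ_continuous continuous_intros continuous_on_compose2[OF f]) auto
  have bd: "\<exists>B. \<forall>x. cmod (of_real (f (cis x))) \<le> B"
  proof -
    have "compact (f ` sphere 0 1)"
      by (intro compact_continuous_image continuous_on_subset[OF f]) auto
    then obtain B where "\<forall>y\<in>f ` sphere 0 1. norm y \<le> B"
      using compact_imp_bounded bounded_iff by blast
    then have "cmod (of_real (f (cis x))) \<le> B" for x
      by auto
    then show ?thesis by blast
  qed
  then have fi: "integrable circ (\<lambda>x. g x * of_real (f (cis x)))"
    using integrable_circ_mult_bounded[OF g(1) fm] by blast
  have "cmod (LINT x|circ. g x * of_real (f (cis x))) \<le> e * I" if "e > 0" for e
  proof -
    obtain q where q: "real_polynomial_function q" "\<And>z. z \<in> sphere 0 1 \<Longrightarrow> \<bar>f z - q z\<bar> < e"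
      using Stone_Weierstrass_real_polynomial_function[of "sphere 0 1" f e]
        continuous_on_subset[OF f] \<open>e > 0\<close> by auto
    have qi: "integrable circ (\<lambda>x. g x * of_real (q (cis x)))"
       "(LINT x|circ. g x * of_real (q (cis x))) = 0"
      using trig_poly_orthogonal[OF g trig_poly_real_polynomial_function[OF q(1)]] by auto
    have "(LINT x|circ. g x * of_real (f (cis x))) =
       (LINT x|circ. g x * of_real (f (cis x)) - g x * of_real (q (cis x)))"
      using fi qi by simp
    also have "cmod \<dots> \<le> (LINT x|circ. e * cmod (g x))"
    proof (rule Bochner_Integration.integral_norm_bound_integral)
      fix x
      have "\<bar>f (cis x) - q (cis x)\<bar> \<le> e"
        using q(2)[of "cis x"] by auto
      then have "cmod (g x) * \<bar>f (cis x) - q (cis x)\<bar> \<le> cmod (g x) * e"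
        by (intro mult_left_mono) auto
      moreover have "cmod (g x * of_real (f (cis x)) - g x * of_real (q (cis x))) =
          cmod (g x) * \<bar>f (cis x) - q (cis x)\<bar>"
        by (metis norm_mult norm_of_real of_real_diff right_diff_distrib)
      ultimately show "cmod (g x * of_real (f (cis x)) - g x * of_real (q (cis x))) \<le> e * cmod (g x)"
        by (simp add: mult.commute)
    qed (use fi qi g in auto)
    finally show ?thesis by (simp add: I_def)
  qed
  then have le: "cmod (LINT x|circ. g x * of_real (f (cis x))) \<le> e * I" if "e > 0" for e
    using that by blast
  have "cmod (LINT x|circ. g x * of_real (f (cis x))) \<le> 0 + e" if "e > 0" for e
  proof -
    \<comment> \<open>Dividing by \<open>I + 1\<close> instead of \<open>I\<close> covers the case
      \<open>I = 0\<close>.\<close>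
    have "e / (I + 1) * I \<le> e"
      using I \<open>e > 0\<close> by (simp add: field_simps)
    then show ?thesis
      using le[of "e / (I + 1)"] I \<open>e > 0\<close> by simp
  qed
  then have "cmod (LINT x|circ. g x * of_real (f (cis x))) \<le> 0"
    by (rule field_le_epsilon)
  then show ?thesis by simp
qed

lemma compact_orthogonal:
  fixes g :: "real \<Rightarrow> complex"
  assumes g: "integrable circ g" "\<And>k. fourier_coeff g k = 0"
    and K: "compact K" "K \<subseteq> {-pi..pi}"
  shows "(LINT x|circ. g x * indicator K x) = 0"
proof (cases "K = {}")
  case False
  define L where "L = cis ` K"
  have L: "closed L" "L \<noteq> {}"
    unfolding L_def using K(1) False
    by (auto intro!: compact_imp_closed compact_continuous_image continuous_intros)
  define f where "f n z = max 0 (1 - real n * infdist z L)" for n z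
  have f_cont: "continuous_on UNIV (f n)" for n
    unfolding f_def by (intro continuous_intros)
  have f_bd: "\<bar>f n z\<bar> \<le> 1" for n z
    unfolding f_def by (auto simp: infdist_nonneg)
  have lim: "(\<lambda>n. f n z) \<longlonglongrightarrow> indicator L z" for z
  proof (cases "z \<in> L")
    case True
    then show ?thesis by (simp add: f_def)
  next
    case False
    then have pos: "infdist z L > 0"
      using L in_closed_iff_infdist_zero infdist_nonneg by (metis less_eq_real_def)
    have "eventually (\<lambda>n. f n z = 0) sequentially"
      using eventually_ge_at_top[of "nat \<lceil>1 / infdist z L\<rceil>"]
    proof eventually_elim
      case (elim n)
      then have "1 / infdist z L \<le> real n" by linarith
      then have "1 \<le> real n * infdist z L" using pos by (simp add: field_simps)
      then show ?case by (simp add: f_def)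
    qed
    then show ?thesis using False by (simp add: tendsto_eventually)
  qed
  \<comment> \<open>The endpoints have to be left out: \<open>cis\<close> identifies
    \<open>-pi\<close> with \<open>pi\<close>, so one may be in \<open>K\<close> and the other not.
    They form a null set.\<close>
  have ind: "indicator L (cis x) = (indicator K x :: real)" if "x \<in> {-pi<..<pi}" for x
  proof -
    have "x \<in> K" if "cis x = cis y" "y \<in> K" for y
    proof -
      from that K have y: "y \<in> {-pi..pi}" by auto
      obtain m where "x = y + 2 * pi * of_int m"
        using \<open>cis x = cis y\<close> by (metis cis_conv_exp exp_eq complex_eq_iff sin_cos_eq_iff cis.sel)
      with y \<open>x \<in> {-pi<..<pi}\<close> have "\<bar>2 * pi * of_int m\<bar> < 2 * pi" by auto
      then have "m = 0" by (simp add: abs_mult)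
      with \<open>x = _\<close> that show ?thesis by simp
    qed
    then show ?thesis by (auto simp: L_def indicator_def)
  qed
  have ae: "AE x in circ. x \<in> {-pi<..<pi}"
  proof -
    have "{-pi, pi} \<in> null_sets circ"
      by (auto simp: null_sets_restrict_space intro: iffD1[OF negligible_iff_null_sets] negligible_finite)
    then show ?thesis
      by (rule AE_I') auto
  qed
  have fm: "(\<lambda>x. complex_of_real (f n (cis x))) \<in> borel_measurable circ" for n
    by (intro measurable_circ_continuous continuous_intros continuous_on_compose2[OF f_cont]) auto
  have "(\<lambda>n. LINT x|circ. g x * of_real (f n (cis x))) \<longlonglongrightarrow> (LINT x|circ. g x * indicator K x)"
  proof (rule integral_dominated_convergence)
    have "K \<in> sets circ" using K by (auto simp: sets_restrict_space image_iff intro!: exI[of _ K] lmeasurable_compact fmeasurableD)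
    then show "(\<lambda>x. g x * indicator K x) \<in> borel_measurable circ"
      using borel_measurable_integrable[OF g(1)] by (intro borel_measurable_times borel_measurable_indicator)
    show "(\<lambda>x. g x * of_real (f n (cis x))) \<in> borel_measurable circ" for n
      using borel_measurable_integrable[OF g(1)] fm by (intro borel_measurable_times)
    show "integrable circ (\<lambda>x. cmod (g x))" using g by auto
    show "AE x in circ. (\<lambda>n. g x * of_real (f n (cis x))) \<longlonglongrightarrow> g x * indicator K x"
      using ae
    proof eventually_elim
      case (elim x)
      have "(\<lambda>n. g x * of_real (f n (cis x))) \<longlonglongrightarrow> g x * of_real (indicator L (cis x))"
        by (intro tendsto_intros lim)
      moreover have "complex_of_real (indicator K x) = indicator K x"
        by (auto simp: indicator_def)
      ultimately show ?case using ind[OF elim] by simp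
    qed
    have "cmod (g x) * \<bar>f n (cis x)\<bar> \<le> cmod (g x)" for x n
      using f_bd by (intro mult_left_le) auto
    then show "AE x in circ. norm (g x * of_real (f n (cis x))) \<le> cmod (g x)" for n
      by (auto simp: norm_mult)
  qed
  moreover have "(LINT x|circ. g x * of_real (f n (cis x))) = 0" for n
    by (rule continuous_orthogonal[OF g f_cont])
  ultimately show ?thesis
    by (simp add: LIMSEQ_const_iff)
qed auto

text \<open>It suffices that \<open>g\<close> integrates to zero over every measurable set. Up to a
  null set such a set is a countable union of compact sets, to which the previous lemma
  applies.\<close>

lemma fourier_coeff_uniqueness:
  assumes g: "integrable circ g" "\<And>k. fourier_coeff g k = 0"
  shows "AE x in circ. g x = 0"
proof (rule sigma_finite_measure.density_zero[OF finite_measure.axioms(1) g(1)])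
  show "finite_measure circ"
    by (simp add: finite_measure_lebesgue_on)
next
  fix A assume "A \<in> sets circ"
  then have A: "A \<in> sets lebesgue" "A \<subseteq> {-pi..pi}"
    by (auto simp: sets_restrict_space intro!: sets.Int)
  obtain C T where C: "fsigma C" "T \<in> null_sets lebesgue" "C \<union> T = A"
    by (rule lebesgue_set_almost_fsigma[OF A(1)])
  obtain F :: "nat \<Rightarrow> real set" where F: "range F \<subseteq> Collect compact" "C = \<Union>(range F)"
    using C(1) unfolding fsigma_Union_compact by blast
  \<comment> \<open>The sets \<open>F i\<close> need not increase; their finite unions do, and stay
    compact, so their indicators converge pointwise to that of \<open>C\<close>.\<close>
  define K where "K n = (\<Union>i\<in>{..<n}. F i)" for n :: nat
  have K: "compact (K n)" "K n \<subseteq> {-pi..pi}" for n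
    using F A C unfolding K_def by (auto intro!: compact_UN)
  have "AE x in circ. x \<notin> T"
    using C(2) A C(3)
    by (auto intro!: AE_not_in simp: null_sets_restrict_space)
  then have ae: "AE x in circ. indicator A x = (indicator C x :: complex)"
    by eventually_elim (use C in \<open>auto simp: indicator_def\<close>)
  have lim: "(\<lambda>n. indicator (K n) x :: complex) \<longlonglongrightarrow> indicator C x" for x
  proof (cases "x \<in> C")
    case True
    then obtain m where "x \<in> F m" using F by auto
    then have "eventually (\<lambda>n. indicator (K n) x = (1::complex)) sequentially"
      by (intro eventually_mono[OF eventually_gt_at_top[of m]]) (auto simp: K_def indicator_def)
    then show ?thesis using True by (simp add: tendsto_eventually)
  next
    case False
    then have "x \<notin> K n" for n using F by (auto simp: K_def)
    then show ?thesis using False by simp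
  qed
  have "(\<lambda>n. LINT x|circ. g x * indicator (K n) x) \<longlonglongrightarrow> (LINT x|circ. g x * indicator A x)"
  proof (rule integral_dominated_convergence)
    show "(\<lambda>x. g x * indicator A x) \<in> borel_measurable circ"
      using borel_measurable_integrable[OF g(1)] \<open>A \<in> sets circ\<close> by (intro borel_measurable_times borel_measurable_indicator)
    have "K n \<in> sets circ" for n
      using K[of n] by (auto simp: sets_restrict_space image_iff intro!: exI[of _ "K n"] lmeasurable_compact fmeasurableD)
    then show "(\<lambda>x. g x * indicator (K n) x) \<in> borel_measurable circ" for n
      using borel_measurable_integrable[OF g(1)] by (intro borel_measurable_times borel_measurable_indicator)
    show "integrable circ (\<lambda>x. cmod (g x))" using g by auto
    show "AE x in circ. (\<lambda>n. g x * indicator (K n) x) \<longlonglongrightarrow> g x * indicator A x"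
      using ae by eventually_elim (auto intro!: tendsto_intros lim)
    show "AE x in circ. norm (g x * indicator (K n) x) \<le> cmod (g x)" for n
      by (auto simp: norm_mult indicator_def)
  qed
  moreover have "(LINT x|circ. g x * indicator (K n) x) = 0" for n
    by (rule compact_orthogonal[OF g K])
  ultimately have "(LINT x|circ. g x * indicator A x) = 0"
    by (simp add: LIMSEQ_const_iff)
  moreover have "(\<lambda>x. g x * indicator A x) = (\<lambda>x. indicator A x *\<^sub>R g x)"
    by (auto simp: indicator_def)
  ultimately show "set_lebesgue_integral circ A g = 0"
    by (simp add: set_lebesgue_integral_def)
qed

section \<open>Absolutely convergent Fourier series\<close>

abbreviation abs_summable :: "(int \<Rightarrow> 'a::real_normed_vector) \<Rightarrow> bool" where
  "abs_summable a \<equiv> (\<lambda>k. norm (a k)) summable_on UNIV"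

text \<open>The field is kept generic because the operation is applied both to complex coefficient
  sequences and to the real sequences of their weighted squares.\<close>

definition convol :: "(int \<Rightarrow> 'a) \<Rightarrow> (int \<Rightarrow> 'a) \<Rightarrow> int \<Rightarrow> 'a::{real_normed_field,banach}" where
  "convol f g k = (\<Sum>\<^sub>\<infinity>j. f j * g (k - j))"

text \<open>Fubini for the absolutely summable family \<open>f j * g l\<close>: the bijection
  sending \<open>(k, j)\<close> to \<open>(j, k - j)\<close> regroups it along the lines on which
  \<open>j + l = k\<close>.\<close>

lemma convol_has_sum:
  fixes f g :: "int \<Rightarrow> 'a::{real_normed_field,banach}"
  assumes "abs_summable f" "abs_summable g"
  shows "(\<lambda>j. f j * g (k - j)) summable_on UNIV"
    and "(convol f g has_sum (infsum f UNIV * infsum g UNIV)) UNIV"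
proof -
  have fs: "f summable_on UNIV" and gs: "g summable_on UNIV"
    using assms by (simp_all add: abs_summable_summable)
  define h where "h = (\<lambda>(j::int, l::int). f j * g l)"
  have h_abs: "(\<lambda>z. norm (h z)) summable_on (UNIV \<times> UNIV)"
    unfolding Infinite_Sum.abs_summable_on_Sigma_iff
    using assms by (auto simp: h_def norm_mult infsum_cmult_right' abs_mult infsum_nonneg
        intro!: summable_on_cmult_right summable_on_cmult_left)
  then have hs: "h summable_on (UNIV \<times> UNIV)"
    by (rule abs_summable_summable)
  have "(h has_sum (infsum f UNIV * infsum g UNIV)) (UNIV \<times> UNIV)"
  proof (rule has_sum_SigmaI[OF _ _ hs])
    show "((\<lambda>l. h (j, l)) has_sum (f j * infsum g UNIV)) UNIV" for j
      unfolding h_def using gs by (auto intro!: has_sum_cmult_right)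
    show "((\<lambda>j. f j * infsum g UNIV) has_sum (infsum f UNIV * infsum g UNIV)) UNIV"
      using fs by (auto intro!: has_sum_cmult_left)
  qed
  moreover have bij: "bij_betw (\<lambda>(k::int, j). (j, k - j)) (UNIV \<times> UNIV) (UNIV \<times> UNIV)"
    by (rule bij_betwI[where g = "\<lambda>(j, l). (j + l, j)"]) auto
  ultimately have sum: "((\<lambda>(k, j). f j * g (k - j)) has_sum (infsum f UNIV * infsum g UNIV)) (UNIV \<times> UNIV)"
    using has_sum_reindex_bij_betw[OF bij, of h] by (simp add: h_def case_prod_unfold)
  have "(\<lambda>z. norm ((\<lambda>(k, j). f j * g (k - j)) z)) summable_on (UNIV \<times> UNIV)"
    using h_abs summable_on_reindex_bij_betw[OF bij, of "\<lambda>z. norm (h z)"]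
    by (simp add: h_def case_prod_unfold)
  then have "abs_summable (\<lambda>j. f j * g (k - j))" for k
    unfolding Infinite_Sum.abs_summable_on_Sigma_iff by simp
  then show *: "(\<lambda>j. f j * g (k - j)) summable_on UNIV" for k
    by (rule abs_summable_summable)
  show "(convol f g has_sum (infsum f UNIV * infsum g UNIV)) UNIV"
    using has_sum_SigmaD[OF sum] * by (auto simp: convol_def)
qed

definition fourier_series :: "(int \<Rightarrow> complex) \<Rightarrow> real \<Rightarrow> complex" where
  "fourier_series a x = (\<Sum>\<^sub>\<infinity>k. a k * cis (of_int k * x))"

lemma fourier_series_has_sum:
  assumes "abs_summable a"
  shows "((\<lambda>k. a k * cis (of_int k * x)) has_sum fourier_series a x) UNIV"
    and "abs_summable (\<lambda>k. a k * cis (of_int k * x))"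
proof -
  show "abs_summable (\<lambda>k. a k * cis (of_int k * x))"
    using assms by (simp add: norm_mult)
  then show "((\<lambda>k. a k * cis (of_int k * x)) has_sum fourier_series a x) UNIV"
    unfolding fourier_series_def by (rule has_sum_infsum[OF abs_summable_summable])
qed

lemma fourier_series_diff:
  assumes "abs_summable a" "abs_summable b"
  shows "fourier_series (\<lambda>k. a k - b k) x = fourier_series a x - fourier_series b x"
  using has_sum_add[OF fourier_series_has_sum(1)[OF assms(1)]
      has_sum_uminusI[OF fourier_series_has_sum(1)[OF assms(2)]], of x x]
  unfolding fourier_series_def by (simp add: infsumI ring_distribs)

text \<open>Conjugation reverses the sign of each frequency. This is the origin of the sequences
  \<open>cnj (a (- k))\<close> in the treatment of the cubic term.\<close>

lemma fourier_series_cnj: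
  "fourier_series (\<lambda>k. cnj (a (- k))) x = cnj (fourier_series a x)"
proof -
  have "fourier_series (\<lambda>k. cnj (a (- k))) x = (\<Sum>\<^sub>\<infinity>k. cnj (a (- k) * cis (of_int (- k) * x)))"
    by (simp add: fourier_series_def cis_cnj)
  also have "\<dots> = cnj (\<Sum>\<^sub>\<infinity>k. a (- k) * cis (of_int (- k) * x))"
    by (rule infsum_cnj)
  also have "(\<Sum>\<^sub>\<infinity>k. a (- k) * cis (of_int (- k) * x)) = fourier_series a x"
    unfolding fourier_series_def
    by (rule infsum_reindex_bij_betw[where g = uminus]) (auto intro!: bij_uminus)
  finally show ?thesis .
qed

lemma fourier_series_convol:
  assumes "abs_summable a" "abs_summable b"
  shows "fourier_series (convol a b) x = fourier_series a x * fourier_series b x"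
proof -
  define a' b' where "a' k = a k * cis (of_int k * x)" and "b' k = b k * cis (of_int k * x)" for k
  have "abs_summable a'" "abs_summable b'"
    using assms by (simp_all add: a'_def b'_def norm_mult)
  from convol_has_sum(2)[OF this]
  have "infsum (convol a' b') UNIV = fourier_series a x * fourier_series b x"
    unfolding a'_def b'_def fourier_series_def by (rule infsumI)
  moreover have "convol a' b' k = convol a b k * cis (of_int k * x)" for k
  proof -
    have "a' j * b' (k - j) = a j * b (k - j) * cis (of_int k * x)" for j
    proof -
      have "cis (of_int k * x) = cis (of_int j * x) * cis (of_int (k - j) * x)"
        by (simp add: cis_mult ring_distribs)
      then show ?thesis by (simp add: a'_def b'_def)
    qed
    then show ?thesis
      by (simp add: convol_def infsum_cmult_left')
  qed
  then have "convol a' b' = (\<lambda>k. convol a b k * cis (of_int k * x))"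
    by blast
  ultimately show ?thesis
    by (simp add: fourier_series_def)
qed

lemma norm_fourier_series_le:
  assumes "abs_summable a"
  shows "norm (fourier_series a x) \<le> (\<Sum>\<^sub>\<infinity>k. norm (a k))"
  unfolding fourier_series_def
  using norm_infsum_bound[OF fourier_series_has_sum(2)[OF assms]] by (simp add: norm_mult)

text \<open>Connects unordered summation over the integers with the symmetric partial sums. A
  sequence of partial sums is what measurability of limits and dominated convergence call
  for.\<close>

lemma filterlim_int_intervals:
  "filterlim (\<lambda>n. {- int n..int n}) (finite_subsets_at_top UNIV) sequentially"
  unfolding filterlim_finite_subsets_at_top
proof safe
  fix X :: "int set" assume X: "finite X"
  define m where "m = nat (Max (insert 0 (abs ` X)))"
  have "X \<subseteq> {- int m..int m}"
  proof
    fix x assume "x \<in> X"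
    then have "\<bar>x\<bar> \<le> Max (insert 0 (abs ` X))" using X by auto
    then show "x \<in> {- int m..int m}" by (auto simp: m_def)
  qed
  then show "\<forall>\<^sub>F y in sequentially. finite {- int y..int y} \<and> X \<subseteq> {- int y..int y} \<and> {- int y..int y} \<subseteq> UNIV"
    by (intro eventually_sequentiallyI[of m]) auto
qed

lemma fourier_series_LIMSEQ:
  assumes "abs_summable a"
  shows "(\<lambda>n. \<Sum>k\<in>{- int n..int n}. a k * cis (of_int k * x)) \<longlonglongrightarrow> fourier_series a x"
  using filterlim_compose[OF _ filterlim_int_intervals] fourier_series_has_sum(1)[OF assms]
  unfolding has_sum_def by blast

lemma measurable_circ_sum_cis:
  "(\<lambda>x. \<Sum>k\<in>A. a k * cis (of_int k * x)) \<in> borel_measurable circ"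
  by (intro measurable_circ_continuous continuous_intros)

lemma measurable_fourier_series:
  assumes "abs_summable a"
  shows "fourier_series a \<in> borel_measurable circ"
  by (rule borel_measurable_LIMSEQ_metric[OF _ fourier_series_LIMSEQ[OF assms]])
    (rule measurable_circ_sum_cis)

lemma finite_measure_circ: "finite_measure circ"
  by (simp add: finite_measure_lebesgue_on)

lemma integrable_circ_bounded:
  fixes f :: "real \<Rightarrow> complex"
  assumes "f \<in> borel_measurable circ" "\<And>x. norm (f x) \<le> B"
  shows "integrable circ f"
  by (rule finite_measure.integrable_const_bound[OF finite_measure_circ, where B = B])
    (use assms in auto)

lemma integrable_fourier_series:
  assumes "abs_summable a"
  shows "integrable circ (fourier_series a)"
  using integrable_circ_bounded[OF measurable_fourier_series norm_fourier_series_le] assms by blast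

lemma integral_circ_cis:
  "(LINT x|circ. cis (of_int k * x)) = (if k = 0 then 2 * pi else 0)"
proof (cases "k = 0")
  case True
  then show ?thesis
    by (simp add: measure_restrict_space scaleR_conv_of_real)
next
  case False
  have "((\<lambda>x. cis (of_int k * x)) has_integral
     (cis (of_int k * pi) / (\<i> * of_int k) - cis (of_int k * (- pi)) / (\<i> * of_int k))) {-pi..pi}"
  proof (rule fundamental_theorem_of_calculus)
    fix x :: real
    have "((\<lambda>x. cis (of_int k * x) / (\<i> * of_int k)) has_vector_derivative
       (of_int k *\<^sub>R (\<i> * cis (of_int k * x)) / (\<i> * of_int k))) (at x within {-pi..pi})"
      unfolding cis_conv_exp
      by (auto intro!: derivative_eq_intros has_vector_derivative_real_field simp: scaleR_conv_of_real)
        (simp add: complex_eq_iff)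
    then show "((\<lambda>x. cis (of_int k * x) / (\<i> * of_int k)) has_vector_derivative cis (of_int k * x))
        (at x within {-pi..pi})"
      using False by (simp add: scaleR_conv_of_real)
  qed auto
  moreover have "cis (of_int k * pi) = cis (of_int k * (- pi))"
    by (auto simp: complex_eq_iff sin_zero_iff_int2)
  ultimately have "((\<lambda>x. cis (of_int k * x)) has_integral 0) {-pi..pi}"
    by simp
  moreover have "integrable circ (\<lambda>x. cis (of_int k * x))"
    by (rule integrable_circ_bounded[where B = 1]) auto
  ultimately show ?thesis
    using False by (simp add: lebesgue_integral_eq_integral integral_unique)
qed

lemma fourier_coeff_cong_AE:
  assumes "AE x in circ. f x = g x" "f \<in> borel_measurable circ" "g \<in> borel_measurable circ"
  shows "fourier_coeff f k = fourier_coeff g k"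
proof -
  have "(LINT x|circ. f x * cis (- (of_int k * x))) = (LINT x|circ. g x * cis (- (of_int k * x)))"
    using assms measurable_circ_cis[of "- of_int k"] by (intro integral_cong_AE) auto
  then show ?thesis by (simp add: fourier_coeff_def)
qed

lemma fourier_coeff_add:
  assumes "integrable circ f" "integrable circ g"
  shows "fourier_coeff (\<lambda>x. f x + g x) k = fourier_coeff f k + fourier_coeff g k"
  using integrable_circ_mult_cis[OF assms(1), of "- of_int k"]
    integrable_circ_mult_cis[OF assms(2), of "- of_int k"]
  by (simp add: fourier_coeff_def ring_distribs add_divide_distrib)

lemma fourier_coeff_diff:
  assumes "integrable circ f" "integrable circ g"
  shows "fourier_coeff (\<lambda>x. f x - g x) k = fourier_coeff f k - fourier_coeff g k"
  using integrable_circ_mult_cis[OF assms(1), of "- of_int k"]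
    integrable_circ_mult_cis[OF assms(2), of "- of_int k"]
  by (simp add: fourier_coeff_def ring_distribs diff_divide_distrib)

lemma fourier_coeff_sum_cis:
  assumes "finite A"
  shows "fourier_coeff (\<lambda>x. \<Sum>j\<in>A. a j * cis (of_int j * x)) k = (if k \<in> A then a k else 0)"
proof -
  have "(\<Sum>j\<in>A. a j * cis (of_int j * x)) * cis (- (of_int k * x)) =
      (\<Sum>j\<in>A. a j * cis (of_int (j - k) * x))" for x
    by (simp add: sum_distrib_right cis_mult ring_distribs mult.assoc)
  then have "(LINT x|circ. (\<Sum>j\<in>A. a j * cis (of_int j * x)) * cis (- (of_int k * x))) =
      (LINT x|circ. (\<Sum>j\<in>A. a j * cis (of_int (j - k) * x)))"
    by simp
  also have "\<dots> = (\<Sum>j\<in>A. a j * (LINT x|circ. cis (of_int (j - k) * x)))"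
  proof -
    have "integrable circ (\<lambda>x. cis (of_int (j - k) * x))" for j
      by (rule integrable_circ_bounded[where B = 1]) auto
    then have "integrable circ (\<lambda>x. a j * cis (of_int (j - k) * x))" for j
      by (intro integrable_mult_right)
    then show ?thesis by (subst Bochner_Integration.integral_sum) auto
  qed
  also have "\<dots> = (\<Sum>j\<in>A. if j = k then a j * (2 * pi) else 0)"
    by (intro sum.cong) (auto simp: integral_circ_cis simp del: of_int_diff)
  also have "\<dots> = (if k \<in> A then a k * (2 * pi) else 0)"
    using assms by simp
  finally show ?thesis by (simp add: fourier_coeff_def)
qed

text \<open>The partial sums are dominated by the constant sum of the \<open>norm (a k)\<close>,
  which is integrable on a finite measure space, and their coefficient at \<open>k\<close> equals
  \<open>a k\<close> as soon as \<open>n\<close> reaches the modulus of \<open>k\<close>.\<close>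

lemma fourier_coeff_fourier_series:
  assumes a: "abs_summable a"
  shows "fourier_coeff (fourier_series a) k = a k"
proof -
  define s where "s n x = (\<Sum>k\<in>{- int n..int n}. a k * cis (of_int k * x))" for n x
  have "(\<lambda>n. LINT x|circ. s n x * cis (- (of_int k * x))) \<longlonglongrightarrow>
      (LINT x|circ. fourier_series a x * cis (- (of_int k * x)))"
  proof (rule integral_dominated_convergence)
    show "(\<lambda>x. fourier_series a x * cis (- (of_int k * x))) \<in> borel_measurable circ"
      using measurable_fourier_series[OF a] measurable_circ_cis[of "- of_int k"]
      by (intro borel_measurable_times) auto
    show "(\<lambda>x. s n x * cis (- (of_int k * x))) \<in> borel_measurable circ" for n
      unfolding s_def using measurable_circ_sum_cis measurable_circ_cis[of "- of_int k"]
      by (intro borel_measurable_times) auto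
    show "integrable circ (\<lambda>x. \<Sum>\<^sub>\<infinity>k. norm (a k))"
      by (rule finite_measure.integrable_const[OF finite_measure_circ])
    have "norm (s n x) \<le> (\<Sum>\<^sub>\<infinity>k. norm (a k))" for n x
      unfolding s_def
      by (rule order_trans[OF sum_norm_le finite_sum_le_infsum]) (use a in \<open>auto simp: norm_mult\<close>)
    then show "AE x in circ. norm (s n x * cis (- (of_int k * x))) \<le> (\<Sum>\<^sub>\<infinity>k. norm (a k))" for n
      by (simp add: norm_mult)
    show "AE x in circ. (\<lambda>n. s n x * cis (- (of_int k * x))) \<longlonglongrightarrow> fourier_series a x * cis (- (of_int k * x))"
      unfolding s_def by (intro AE_I2 tendsto_intros fourier_series_LIMSEQ a)
  qed
  then have "(\<lambda>n. fourier_coeff (s n) k) \<longlonglongrightarrow> fourier_coeff (fourier_series a) k"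
    unfolding fourier_coeff_def by (intro tendsto_divide) auto
  moreover have "eventually (\<lambda>n. fourier_coeff (s n) k = a k) sequentially"
    using eventually_ge_at_top[of "nat \<bar>k\<bar>"]
  proof eventually_elim
    case (elim n)
    then have "k \<in> {- int n..int n}" by auto
    then show ?case unfolding s_def by (subst fourier_coeff_sum_cis) auto
  qed
  ultimately show ?thesis
    using tendsto_unique[OF _ _ tendsto_eventually] by (metis trivial_limit_sequentially)
qed

text \<open>Here uniqueness is applied, to the difference of the two sides. It gives
  \<open>u\<close> a representative for which products of functions are convolutions of
  coefficients.\<close>

lemma fourier_series_fourier_coeff_AE:
  assumes "integrable circ u" "abs_summable (fourier_coeff u)"
  shows "AE x in circ. u x = fourier_series (fourier_coeff u) x"
proof -
  have "AE x in circ. u x - fourier_series (fourier_coeff u) x = 0"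
  proof (rule fourier_coeff_uniqueness)
    show "integrable circ (\<lambda>x. u x - fourier_series (fourier_coeff u) x)"
      using assms integrable_fourier_series by (intro Bochner_Integration.integrable_diff) auto
    show "fourier_coeff (\<lambda>x. u x - fourier_series (fourier_coeff u) x) k = 0" for k
      using assms integrable_fourier_series[OF assms(2)]
      by (simp add: fourier_coeff_diff fourier_coeff_fourier_series)
  qed
  then show ?thesis by simp
qed

section \<open>Weighted square summable sequences\<close>

definition weight :: "real \<Rightarrow> int \<Rightarrow> real" where
  "weight s k = (1 + (of_int k)\<^sup>2) powr s"

lemma weight_pos: "weight s k > 0"
  using add_pos_nonneg[OF zero_less_one zero_le_power2[of "real_of_int k"]]
  by (simp add: weight_def)

lemma weight_ge_1:
  assumes "s \<ge> 0"
  shows "weight s k \<ge> 1"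
  unfolding weight_def using assms by (intro ge_one_powr_ge_zero) auto

lemma weight_minus [simp]: "weight s (- k) = weight s k"
  by (simp add: weight_def)

text \<open>From the convexity bound for the square of \<open>j + (k - j)\<close> one gets
  \<open>1 + k^2\<close> at most 4 times the larger of the two factors \<open>x\<close>,
  \<open>y\<close>. The assumption \<open>s \<le> 1\<close> keeps \<open>4 powr s\<close> below
  4.\<close>

lemma weight_peetre:
  assumes "0 \<le> s" "s \<le> 1"
  shows "weight s k \<le> 4 * (weight s j + weight s (k - j))"
proof -
  define x y where "x = 1 + (of_int j :: real)\<^sup>2" and "y = 1 + (of_int (k - j) :: real)\<^sup>2"
  have xy: "x \<ge> 1" "y \<ge> 1" by (auto simp: x_def y_def)
  have "(of_int k :: real)\<^sup>2 \<le> 2 * (of_int j)\<^sup>2 + 2 * (of_int (k - j))\<^sup>2"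
    using zero_le_power2[of "of_int j - of_int (k - j) :: real"]
    by (simp add: power2_eq_square algebra_simps)
  then have "1 + (of_int k :: real)\<^sup>2 \<le> 4 * max x y"
    by (auto simp: x_def y_def max_def)
  then have "weight s k \<le> (4 * max x y) powr s"
    unfolding weight_def using assms by (intro powr_mono2) auto
  also have "\<dots> = 4 powr s * max x y powr s"
    using xy by (intro powr_mult)
  also have "\<dots> \<le> 4 * max x y powr s"
    using assms powr_mono[of s 1 4] by (intro mult_right_mono) auto
  also have "max x y powr s \<le> weight s j + weight s (k - j)"
    by (auto simp: weight_def x_def y_def max_def)
  finally show ?thesis by simp
qed

lemma summable_on_int_even:
  fixes f :: "int \<Rightarrow> real"
  assumes "summable (\<lambda>n. f (int n))" "\<And>k. f (- k) = f k" "\<And>k. f k \<ge> 0"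
  shows "f summable_on UNIV"
proof -
  have *: "(\<lambda>n. f (int n)) summable_on (UNIV :: nat set)"
    using assms by (simp add: summable_on_UNIV_nonneg_real_iff)
  then have "f summable_on range int"
    by (subst summable_on_reindex) (auto simp: o_def)
  moreover have "f summable_on range (\<lambda>n. - int n)"
    using * assms(2) by (subst summable_on_reindex) (auto simp: o_def inj_on_def)
  ultimately have "f summable_on (range int \<union> range (\<lambda>n. - int n))"
    by (rule summable_on_union)
  also have "range int \<union> range (\<lambda>n. - int n) = UNIV"
  proof safe
    fix k :: int assume "k \<notin> range (\<lambda>n. - int n)"
    then show "k \<in> range int" by (metis int_cases2 rangeI)
  qed auto
  finally show ?thesis .
qed

lemma summable_inverse_weight:
  assumes "s > 1 / 2"
  shows "(\<lambda>k. 1 / weight s k) summable_on UNIV"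
proof (rule summable_on_int_even)
  have "summable (\<lambda>n. real n powr (- 2 * s))"
    using assms by (simp add: summable_real_powr_iff)
  then show "summable (\<lambda>n. 1 / weight s (int n))"
  \<comment> \<open>The comparison starts at 1: at \<open>n = 0\<close> the majorant is
    \<open>0 powr (- 2 * s) = 0\<close> while the weight is 1.\<close>
  proof (rule summable_comparison_test_ev[rotated], intro eventually_sequentiallyI[of 1])
    fix n :: nat assume "1 \<le> n"
    then have "real n powr (2 * s) = ((real n)\<^sup>2) powr s"
      by (simp add: powr_powr flip: powr_numeral)
    also have "\<dots> \<le> weight s (int n)"
      unfolding weight_def using assms by (intro powr_mono2) auto
    finally have "1 / weight s (int n) \<le> 1 / real n powr (2 * s)"
      using \<open>1 \<le> n\<close> by (intro divide_left_mono mult_pos_pos weight_pos) auto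
    then show "norm (1 / weight s (int n)) \<le> real n powr (- 2 * s)"
      using weight_pos[of s "int n"] by (simp add: powr_minus_divide)
  qed
qed (auto simp: less_imp_le[OF weight_pos])

text \<open>The finite inequality bounds all finite sums of \<open>h\<close> uniformly, which gives
  the summability of \<open>h\<close> along with the estimate. Asking for
  \<open>(h x)\<^sup>2 \<le> f x * g x\<close> instead of a product form lets weights be distributed
  between \<open>f\<close> and \<open>g\<close> without taking roots.\<close>

lemma infsum_Cauchy_Schwarz:
  fixes f g h :: "'a \<Rightarrow> real"
  assumes "f summable_on A" "g summable_on A"
    and "\<And>x. x \<in> A \<Longrightarrow> f x \<ge> 0" "\<And>x. x \<in> A \<Longrightarrow> g x \<ge> 0" "\<And>x. x \<in> A \<Longrightarrow> h x \<ge> 0"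
    and h: "\<And>x. x \<in> A \<Longrightarrow> (h x)\<^sup>2 \<le> f x * g x"
  shows "(infsum h A)\<^sup>2 \<le> infsum f A * infsum g A"
proof -
  have le: "h x \<le> sqrt (f x) * sqrt (g x)" if "x \<in> A" for x
    using h[OF that] assms that by (metis real_le_rsqrt real_sqrt_mult)
  have fin: "sum h F \<le> sqrt (infsum f A * infsum g A)" if F: "finite F" "F \<subseteq> A" for F
  proof -
    have "sum h F \<le> (\<Sum>x\<in>F. sqrt (f x) * sqrt (g x))"
      using le F by (intro sum_mono) auto
    also have "\<dots> \<le> sqrt ((\<Sum>x\<in>F. (sqrt (f x))\<^sup>2) * (\<Sum>x\<in>F. (sqrt (g x))\<^sup>2))"
      by (intro real_le_rsqrt Cauchy_Schwarz_ineq_sum)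
    also have "(\<Sum>x\<in>F. (sqrt (f x))\<^sup>2) = sum f F"
      using assms F by (intro sum.cong) auto
    also have "(\<Sum>x\<in>F. (sqrt (g x))\<^sup>2) = sum g F"
      using assms F by (intro sum.cong) auto
    also have "sqrt (sum f F * sum g F) \<le> sqrt (infsum f A * infsum g A)"
      using assms F
      by (intro real_sqrt_le_mono mult_mono finite_sum_le_infsum sum_nonneg infsum_nonneg) auto
    finally show ?thesis .
  qed
  have "h summable_on A"
    using fin assms by (intro nonneg_bdd_above_summable_on bdd_aboveI2[of _ _ "sqrt (infsum f A * infsum g A)"]) auto
  then have "infsum h A \<le> sqrt (infsum f A * infsum g A)"
    using fin by (intro infsum_le_finite_sums) auto
  moreover have "infsum h A \<ge> 0"
    using assms by (intro infsum_nonneg) auto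
  ultimately have "(infsum h A)\<^sup>2 \<le> (sqrt (infsum f A * infsum g A))\<^sup>2"
    by (intro power_mono) auto
  also have "\<dots> = infsum f A * infsum g A"
    using assms by (simp add: infsum_nonneg)
  finally show ?thesis .
qed

definition sobolev_seq :: "real \<Rightarrow> (int \<Rightarrow> complex) \<Rightarrow> bool" where
  "sobolev_seq s a \<longleftrightarrow> (\<lambda>k. weight s k * (cmod (a k))\<^sup>2) summable_on UNIV"

text \<open>The square of the Sobolev norm, as a function of the coefficients. Squares can be
  differentiated in time and fit the differential inequality; the root is taken only at the very
  end.\<close>

definition sobolev_sq :: "real \<Rightarrow> (int \<Rightarrow> complex) \<Rightarrow> real" where
  "sobolev_sq s a = (\<Sum>\<^sub>\<infinity>k. weight s k * (cmod (a k))\<^sup>2)"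

lemma weighted_nonneg: "weight s k * (cmod z)\<^sup>2 \<ge> 0"
  using weight_pos[of s k] by simp

lemma sobolev_sq_nonneg: "sobolev_sq s a \<ge> 0"
  unfolding sobolev_sq_def by (intro infsum_nonneg weighted_nonneg)

text \<open>Requiring only a pointwise bound on \<open>c\<close> covers sums and differences alike;
  the constant is that of \<open>(x + y)^2 \<le> 2 * x^2 + 2 * y^2\<close>.\<close>

lemma sobolev_seq_add_sq:
  assumes a: "sobolev_seq s a" and b: "sobolev_seq s b"
    and c: "\<And>k. cmod (c k) \<le> cmod (a k) + cmod (b k)"
  shows "sobolev_seq s c" and "sobolev_sq s c \<le> 2 * sobolev_sq s a + 2 * sobolev_sq s b"
proof -
  have le: "weight s k * (cmod (c k))\<^sup>2 \<le>
      2 * (weight s k * (cmod (a k))\<^sup>2) + 2 * (weight s k * (cmod (b k))\<^sup>2)" for k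
  proof -
    have "(cmod (c k))\<^sup>2 \<le> (cmod (a k) + cmod (b k))\<^sup>2"
      by (intro power_mono c) auto
    also have "\<dots> \<le> 2 * (cmod (a k))\<^sup>2 + 2 * (cmod (b k))\<^sup>2"
      using zero_le_power2[of "cmod (a k) - cmod (b k)"] by (simp add: power2_eq_square algebra_simps)
    finally show ?thesis
      using mult_left_mono[OF _ less_imp_le[OF weight_pos[of s k]]] by (fastforce simp: algebra_simps)
  qed
  have "((\<lambda>k. 2 * (weight s k * (cmod (a k))\<^sup>2) + 2 * (weight s k * (cmod (b k))\<^sup>2)) has_sum
      (2 * sobolev_sq s a + 2 * sobolev_sq s b)) UNIV"
    using a b unfolding sobolev_seq_def sobolev_sq_def
    by (intro has_sum_add has_sum_cmult_right has_sum_infsum)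
  note sum = this
  show seq: "sobolev_seq s c"
    unfolding sobolev_seq_def
    by (rule summable_on_comparison_test[OF has_sum_imp_summable[OF sum]]) (auto intro: le weighted_nonneg)
  show "sobolev_sq s c \<le> 2 * sobolev_sq s a + 2 * sobolev_sq s b"
    using seq unfolding sobolev_seq_def sobolev_sq_def[of s c]
    by (intro has_sum_mono[OF has_sum_infsum sum]) (auto intro: le)
qed

lemma sobolev_seq_finite_support:
  assumes "finite A" "\<And>k. k \<notin> A \<Longrightarrow> a k = 0"
  shows "sobolev_seq s a" "sobolev_sq s a = (\<Sum>k\<in>A. weight s k * (cmod (a k))\<^sup>2)"
proof -
  have "((\<lambda>k. weight s k * (cmod (a k))\<^sup>2) has_sum (\<Sum>k\<in>A. weight s k * (cmod (a k))\<^sup>2)) UNIV"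
    using assms by (intro has_sum_finite_neutralI) auto
  then show "sobolev_seq s a" "sobolev_sq s a = (\<Sum>k\<in>A. weight s k * (cmod (a k))\<^sup>2)"
    by (auto simp: sobolev_seq_def sobolev_sq_def has_sum_imp_summable infsumI)
qed

lemma sobolev_seq_cnj:
  assumes "sobolev_seq s a"
  shows "sobolev_seq s (\<lambda>k. cnj (a (- k)))"
    and "sobolev_sq s (\<lambda>k. cnj (a (- k))) = sobolev_sq s a"
  using assms
    summable_on_reindex_bij_betw[of uminus UNIV UNIV "\<lambda>k. weight s k * (cmod (a k))\<^sup>2"]
    infsum_reindex_bij_betw[of uminus UNIV UNIV "\<lambda>k. weight s k * (cmod (a k))\<^sup>2"]
  by (auto simp: sobolev_seq_def sobolev_sq_def bij_uminus)

text \<open>The elementary bound \<open>x \<le> w * x^2 + 1 / w\<close> reduces the claim to two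
  summable families; \<open>s > 1 / 2\<close> is what makes the inverse weights summable.\<close>

lemma sobolev_seq_abs_summable:
  assumes "s > 1 / 2" "sobolev_seq s a"
  shows "abs_summable a"
proof (rule summable_on_comparison_test)
  show "(\<lambda>k. weight s k * (cmod (a k))\<^sup>2 + 1 / weight s k) summable_on UNIV"
    using assms summable_inverse_weight by (intro summable_on_add) (auto simp: sobolev_seq_def)
  fix k
  define w where "w = weight s k"
  have w: "w > 0" by (simp add: w_def weight_pos)
  have "0 \<le> (w * cmod (a k) - 1)\<^sup>2 + w * cmod (a k)"
    using w by (intro add_nonneg_nonneg) auto
  then have "w * cmod (a k) \<le> w * (w * (cmod (a k))\<^sup>2 + 1 / w)"
    using w by (simp add: power2_eq_square algebra_simps)
  then show "norm (a k) \<le> weight s k * (cmod (a k))\<^sup>2 + 1 / weight s k"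
    using w by (simp add: w_def)
qed auto

text \<open>The factor 8 is the 4 of \<open>weight_peetre\<close> times 2, since each of the two
  terms there leaves a full sum of inverse weights.\<close>

definition sobolev_const :: "real \<Rightarrow> real" where
  "sobolev_const s = 8 * (\<Sum>\<^sub>\<infinity>k. 1 / weight s k)"

lemma sobolev_const_nonneg: "sobolev_const s \<ge> 0"
  unfolding sobolev_const_def by (auto intro!: infsum_nonneg simp: less_imp_le[OF weight_pos])

text \<open>Cauchy--Schwarz in the convolution sum, after inserting the weights of the two factors,
  reduces the algebra property to the boundedness of
  \<open>\<Sum>j. weight s k / (weight s j * weight s (k - j))\<close> in \<open>k\<close>.\<close>

lemma weight_quotient_summable:
  assumes "1 / 2 < s" "s \<le> 1"
  shows "(\<lambda>j. weight s k / (weight s j * weight s (k - j))) summable_on UNIV"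
    and "(\<Sum>\<^sub>\<infinity>j. weight s k / (weight s j * weight s (k - j))) \<le> sobolev_const s"
proof -
  define S where "S = (\<Sum>\<^sub>\<infinity>k. 1 / weight s k)"
  have S: "((\<lambda>k. 1 / weight s k) has_sum S) UNIV"
    unfolding S_def using summable_inverse_weight[OF assms(1)] by simp
  have bij: "bij_betw (\<lambda>j. k - j) UNIV (UNIV :: int set)"
    by (rule bij_betwI[where g = "\<lambda>j. k - j"]) auto
  have "((\<lambda>j. 1 / weight s (k - j)) has_sum S) UNIV"
    using has_sum_reindex_bij_betw[OF bij, of "\<lambda>k. 1 / weight s k"] S by simp
  from has_sum_cmult_right[OF has_sum_add[OF this S], of 4]
  have sum: "((\<lambda>j. 4 * (1 / weight s (k - j) + 1 / weight s j)) has_sum sobolev_const s) UNIV"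
    by (simp add: S_def sobolev_const_def)
  have le: "weight s k / (weight s j * weight s (k - j)) \<le> 4 * (1 / weight s (k - j) + 1 / weight s j)" for j
  proof -
    have "weight s k / (weight s j * weight s (k - j)) \<le>
        4 * (weight s j + weight s (k - j)) / (weight s j * weight s (k - j))"
      using weight_peetre[of s k j] assms weight_pos[of s j] weight_pos[of s "k - j"]
      by (intro divide_right_mono) auto
    also have "\<dots> = 4 * (1 / weight s (k - j) + 1 / weight s j)"
      using weight_pos[of s j] weight_pos[of s "k - j"] by (simp add: field_simps)
    finally show ?thesis .
  qed
  have nonneg: "0 \<le> weight s k / (weight s j * weight s (k - j))" for j
    by (intro divide_nonneg_nonneg mult_nonneg_nonneg less_imp_le[OF weight_pos])
  show summ: "(\<lambda>j. weight s k / (weight s j * weight s (k - j))) summable_on UNIV"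
    by (rule summable_on_comparison_test[OF has_sum_imp_summable[OF sum]]) (rule le, rule nonneg)
  show "(\<Sum>\<^sub>\<infinity>j. weight s k / (weight s j * weight s (k - j))) \<le> sobolev_const s"
    by (rule has_sum_mono[OF has_sum_infsum[OF summ] sum]) (rule le)
qed

text \<open>With \<open>A\<close> and \<open>B\<close> the weighted squares, the estimate bounds the
  weighted square of \<open>convol a b\<close> at each \<open>k\<close> by a constant times
  \<open>convol A B k\<close>. Summing over \<open>k\<close> then costs nothing more, because the
  total of \<open>convol A B\<close> is the product of the totals of \<open>A\<close> and
  \<open>B\<close>.\<close>

lemma sobolev_seq_convol:
  assumes s: "1 / 2 < s" "s \<le> 1" and a: "sobolev_seq s a" and b: "sobolev_seq s b"
  shows "sobolev_seq s (convol a b)"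
    and "sobolev_sq s (convol a b) \<le> sobolev_const s * sobolev_sq s a * sobolev_sq s b"
proof -
  define A B where "A = (\<lambda>k. weight s k * (cmod (a k))\<^sup>2)" and "B = (\<lambda>k. weight s k * (cmod (b k))\<^sup>2)"
  have AB: "abs_summable A" "abs_summable B"
    using a b by (auto simp: A_def B_def sobolev_seq_def weighted_nonneg)
  have nonneg: "A k \<ge> 0" "B k \<ge> 0" for k
    by (simp_all add: A_def B_def weighted_nonneg)
  have AB_sum: "(convol A B has_sum (sobolev_sq s a * sobolev_sq s b)) UNIV"
    using convol_has_sum(2)[OF AB] by (simp add: A_def B_def sobolev_sq_def)
  have abs: "abs_summable a" "abs_summable b"
    using a b s sobolev_seq_abs_summable by auto
  have le: "weight s k * (cmod (convol a b k))\<^sup>2 \<le> sobolev_const s * convol A B k" for k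
  proof -
    define q where "q j = weight s k / (weight s j * weight s (k - j))" for j
    define h where "h j = cmod (a j) * cmod (b (k - j))" for j
    have hsum: "abs_summable (\<lambda>j. a j * b (k - j))"
      using convol_has_sum(1)[of "\<lambda>j. cmod (a j)" "\<lambda>j. cmod (b j)" k] abs by (simp add: norm_mult)
    have "cmod (convol a b k) \<le> infsum h UNIV"
      unfolding convol_def h_def using norm_infsum_bound[OF hsum] by (simp add: norm_mult)
    then have "(cmod (convol a b k))\<^sup>2 \<le> (infsum h UNIV)\<^sup>2"
      by (intro power_mono) auto
    then have "weight s k * (cmod (convol a b k))\<^sup>2 \<le> weight s k * (infsum h UNIV)\<^sup>2"
      by (intro mult_left_mono less_imp_le[OF weight_pos])
    also have "\<dots> = (\<Sum>\<^sub>\<infinity>j. sqrt (weight s k) * h j)\<^sup>2"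
      using weight_pos[of s k] by (simp add: infsum_cmult_right' power_mult_distrib)
    \<comment> \<open>The weights of the factors cancel between \<open>q j\<close> and
      \<open>A j * B (k - j)\<close>, so the pointwise hypothesis holds with equality.\<close>
    also have "\<dots> \<le> infsum q UNIV * (\<Sum>\<^sub>\<infinity>j. A j * B (k - j))"
    proof (rule infsum_Cauchy_Schwarz)
      show "q summable_on UNIV"
        unfolding q_def by (rule weight_quotient_summable[OF s])
      show "(\<lambda>j. A j * B (k - j)) summable_on UNIV"
        by (rule convol_has_sum[OF AB])
      fix j
      show "0 \<le> q j"
        unfolding q_def by (intro divide_nonneg_nonneg mult_nonneg_nonneg less_imp_le[OF weight_pos])
      show "0 \<le> A j * B (k - j)" "0 \<le> sqrt (weight s k) * h j"
        using nonneg weight_pos[of s k] by (auto simp: h_def)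
      show "(sqrt (weight s k) * h j)\<^sup>2 \<le> q j * (A j * B (k - j))"
        using weight_pos[of s k] weight_pos[of s j] weight_pos[of s "k - j"]
        by (simp add: q_def A_def B_def h_def power_mult_distrib)
    qed
    also have "\<dots> \<le> sobolev_const s * convol A B k"
      unfolding q_def convol_def using nonneg
      by (intro mult_right_mono weight_quotient_summable s infsum_nonneg) auto
    finally show ?thesis .
  qed
  have sum: "((\<lambda>k. sobolev_const s * convol A B k) has_sum (sobolev_const s * (sobolev_sq s a * sobolev_sq s b))) UNIV"
    by (intro has_sum_cmult_right AB_sum)
  show seq: "sobolev_seq s (convol a b)"
    unfolding sobolev_seq_def
    by (rule summable_on_comparison_test[OF has_sum_imp_summable[OF sum]]) (auto intro: le weighted_nonneg)
  show "sobolev_sq s (convol a b) \<le> sobolev_const s * sobolev_sq s a * sobolev_sq s b"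
    using has_sum_mono[OF has_sum_infsum sum] seq le
    unfolding sobolev_seq_def sobolev_sq_def[of s "convol a b"] by (simp add: mult.assoc)
qed

section \<open>The equations in Fourier variables\<close>

lemma L2_per_integrable:
  assumes "u \<in> L2_per"
  shows "integrable circ u"
proof (rule Bochner_Integration.integrable_bound)
  show "integrable circ (\<lambda>x. 1 + (cmod (u x))\<^sup>2)"
    using assms finite_measure.integrable_const[OF finite_measure_circ]
    by (intro Bochner_Integration.integrable_add) (auto simp: L2_per_def)
  have "cmod z \<le> 1 + (cmod z)\<^sup>2" for z :: complex
  proof -
    have "0 \<le> (cmod z)\<^sup>2 + 1 - 2 * cmod z"
      using zero_le_power2[of "cmod z - 1"] by (simp add: power2_diff)
    then show ?thesis using norm_ge_zero[of z] by linarith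
  qed
  then show "AE x in circ. norm (u x) \<le> norm (1 + (cmod (u x))\<^sup>2)"
    by (intro AE_I2) (metis abs_ge_self order_trans real_norm_def)
qed (use assms in \<open>simp add: L2_per_def\<close>)

lemma sobolev_space_iff: "u \<in> sobolev_space \<mu> \<longleftrightarrow> u \<in> L2_per \<and> sobolev_seq \<mu> (fourier_coeff u)"
  by (simp add: sobolev_space_def sobolev_seq_def weight_def)

lemma sobolev_norm_eq: "sobolev_norm \<mu> u = sqrt (sobolev_sq \<mu> (fourier_coeff u))"
  by (simp add: sobolev_norm_def sobolev_sq_def weight_def)

lemma measurable_cubic:
  assumes "u \<in> borel_measurable circ"
  shows "cubic u \<in> borel_measurable circ"
  unfolding cubic_def[abs_def] using assms by measurable

lemma fourier_coeff_cubic: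
  assumes "integrable circ u" "abs_summable (fourier_coeff u)"
  shows "fourier_coeff (cubic u) k = fourier_coeff (cubic (fourier_series (fourier_coeff u))) k"
proof (rule fourier_coeff_cong_AE)
  show "AE x in circ. cubic u x = cubic (fourier_series (fourier_coeff u)) x"
    using fourier_series_fourier_coeff_AE[OF assms] by eventually_elim (simp add: cubic_def)
qed (use assms measurable_cubic measurable_fourier_series borel_measurable_integrable in auto)

lemma integrable_cubic_fourier_series:
  assumes "abs_summable a"
  shows "integrable circ (cubic (fourier_series a))"
proof (rule integrable_circ_bounded)
  show "cubic (fourier_series a) \<in> borel_measurable circ"
    by (intro measurable_cubic measurable_fourier_series assms)
  fix x
  show "norm (cubic (fourier_series a) x) \<le> (\<Sum>\<^sub>\<infinity>k. norm (a k))\<^sup>2 * (\<Sum>\<^sub>\<infinity>k. norm (a k))"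
    unfolding cubic_def
    by (auto simp: norm_mult norm_power intro!: mult_mono power_mono norm_fourier_series_le assms infsum_nonneg)
qed

text \<open>Replacing one factor at a time in \<open>f * f * cnj f\<close> writes the difference of
  the cubics as three products, each containing the error exactly once. Applying the algebra
  property twice to each gives \<open>C\<^sup>2\<close>. Adding three terms by two uses of
  \<open>sobolev_seq_add_sq\<close> gives the factors 2, 4, 4, and the 2 is rounded up to 4.\<close>

lemma sobolev_sq_cubic_diff:
  assumes s: "1 / 2 < s" "s \<le> 1"
    and u: "integrable circ u" "sobolev_seq s (fourier_coeff u)"
    and v: "integrable circ v" "sobolev_seq s (fourier_coeff v)"
  defines "A \<equiv> sobolev_sq s (fourier_coeff u)" and "B \<equiv> sobolev_sq s (fourier_coeff v)"
    and "E \<equiv> sobolev_sq s (\<lambda>k. fourier_coeff v k - fourier_coeff u k)"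
    and "d \<equiv> (\<lambda>k. fourier_coeff (cubic v) k - fourier_coeff (cubic u) k)"
  shows "sobolev_seq s d" and "sobolev_sq s d \<le> 4 * (sobolev_const s)\<^sup>2 * (B\<^sup>2 + A * B + A\<^sup>2) * E"
proof -
  define a b e where "a = fourier_coeff u" and "b = fourier_coeff v" and "e = (\<lambda>k. b k - a k)"
  define C where "C = sobolev_const s"
  note defs = a_def b_def e_def
  have a: "sobolev_seq s a" and b: "sobolev_seq s b" using u v by (auto simp: defs)
  have e: "sobolev_seq s e"
    by (rule sobolev_seq_add_sq(1)[OF a b]) (simp add: e_def norm_triangle_ineq4 norm_minus_commute add.commute)
  \<comment> \<open>In function terms these are \<open>e * b * cnj b\<close>,
    \<open>a * e * cnj b\<close> and \<open>a * a * cnj e\<close>.\<close>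
  define t1 t2 t3 where "t1 = convol (convol e b) (\<lambda>k. cnj (b (- k)))"
    and "t2 = convol (convol a e) (\<lambda>k. cnj (b (- k)))"
    and "t3 = convol (convol a a) (\<lambda>k. cnj (e (- k)))"
  note ts = t1_def t2_def t3_def
  note conv = sobolev_seq_convol(1)[OF s] sobolev_seq_cnj(1)
  have t: "sobolev_seq s t1" "sobolev_seq s t2" "sobolev_seq s t3"
    unfolding ts using a b e by (auto intro: conv)
  note summ = sobolev_seq_abs_summable[OF s(1)]
  have prod: "fourier_series (convol (convol f g) (\<lambda>k. cnj (h (- k)))) x =
      fourier_series f x * fourier_series g x * cnj (fourier_series h x)"
    if "sobolev_seq s f" "sobolev_seq s g" "sobolev_seq s h" for f g h x
    by (simp add: fourier_series_cnj fourier_series_convol[OF summ[OF that(1)] summ[OF that(2)]]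
        fourier_series_convol[OF summ[OF conv(1)[OF that(1,2)]] summ[OF conv(2)[OF that(3)]]])
  have cubic_eq: "cubic f x = f x * f x * cnj (f x)" for f x
    by (simp only: cubic_def complex_norm_square mult_ac)
  have e_eq: "fourier_series e x = fourier_series b x - fourier_series a x" for x
    unfolding e_def by (rule fourier_series_diff) (auto intro: summ a b)
  have "cubic (fourier_series b) x =
      cubic (fourier_series a) x + (fourier_series t1 x + (fourier_series t2 x + fourier_series t3 x))" for x
    unfolding ts prod[OF e b b] prod[OF a e b] prod[OF a a e] cubic_eq e_eq
    by (simp add: algebra_simps)
  then have "fourier_coeff (cubic (fourier_series b)) k =
      fourier_coeff (\<lambda>x. cubic (fourier_series a) x + (fourier_series t1 x + (fourier_series t2 x + fourier_series t3 x))) k" for k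
    by metis
  also have "\<dots> k = fourier_coeff (cubic (fourier_series a)) k + (t1 k + (t2 k + t3 k))" for k
    by (simp add: fourier_coeff_add integrable_fourier_series integrable_cubic_fourier_series
        fourier_coeff_fourier_series summ a t)
  finally have d: "d k = t1 k + (t2 k + t3 k)" for k
    unfolding d_def using fourier_coeff_cubic[OF u(1), of k] fourier_coeff_cubic[OF v(1), of k]
      summ[OF u(2)] summ[OF v(2)] by (simp add: a_def b_def)
  define g where "g = (\<lambda>k. t2 k + t3 k)"
  have g: "sobolev_seq s g" "sobolev_sq s g \<le> 2 * sobolev_sq s t2 + 2 * sobolev_sq s t3"
    using sobolev_seq_add_sq[OF t(2,3), of g] by (auto simp: g_def norm_triangle_ineq)
  have dd: "sobolev_seq s d" "sobolev_sq s d \<le> 2 * sobolev_sq s t1 + 2 * sobolev_sq s g"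
    using sobolev_seq_add_sq[OF t(1) g(1), of d] by (auto simp: g_def d norm_triangle_ineq)
  show "sobolev_seq s d" by fact
  have triple: "sobolev_sq s (convol (convol f g) (\<lambda>k. cnj (h (- k)))) \<le>
      C\<^sup>2 * (sobolev_sq s f * sobolev_sq s g * sobolev_sq s h)"
    if "sobolev_seq s f" "sobolev_seq s g" "sobolev_seq s h" for f g h
  proof -
    have "sobolev_sq s (convol (convol f g) (\<lambda>k. cnj (h (- k)))) \<le>
        C * sobolev_sq s (convol f g) * sobolev_sq s h"
      using sobolev_seq_convol(2)[OF s conv(1)[OF that(1,2)] conv(2)[OF that(3)]] sobolev_seq_cnj(2)[OF that(3)]
      by (simp add: C_def)
    also have "\<dots> \<le> C * (C * sobolev_sq s f * sobolev_sq s g) * sobolev_sq s h"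
      using sobolev_seq_convol(2)[OF s that(1,2)] sobolev_const_nonneg[of s]
      by (intro mult_right_mono mult_left_mono sobolev_sq_nonneg) (auto simp: C_def)
    finally show ?thesis by (simp add: power2_eq_square mult_ac)
  qed
  have AB: "A = sobolev_sq s a" "B = sobolev_sq s b" "E = sobolev_sq s e"
    by (simp_all add: A_def B_def E_def defs)
  have "sobolev_sq s t1 \<le> C\<^sup>2 * (E * B * B)" "sobolev_sq s t2 \<le> C\<^sup>2 * (A * E * B)"
    "sobolev_sq s t3 \<le> C\<^sup>2 * (A * A * E)"
    unfolding ts AB using a b e by (auto intro: triple)
  then have "sobolev_sq s d \<le> 2 * (C\<^sup>2 * (E * B * B)) + 4 * (C\<^sup>2 * (A * E * B)) + 4 * (C\<^sup>2 * (A * A * E))"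
    using dd(2) g(2) by linarith
  moreover have "0 \<le> C\<^sup>2 * (E * B * B)"
    by (simp add: AB sobolev_sq_nonneg)
  ultimately show "sobolev_sq s d \<le> 4 * (sobolev_const s)\<^sup>2 * (B\<^sup>2 + A * B + A\<^sup>2) * E"
    by (simp add: C_def power2_eq_square algebra_simps)
qed

section \<open>Exponentials as test functions and the coefficient equations of the exact
  solution\<close>

lemma has_vector_derivative_cis:
  "((\<lambda>x. c * cis (of_int k * x)) has_vector_derivative (c * \<i> * of_int k) * cis (of_int k * x)) (at x)"
  unfolding cis_conv_exp
  by (auto intro!: derivative_eq_intros has_vector_derivative_real_field simp: scaleR_conv_of_real)

text \<open>Every derivative is a scalar multiple of the same exponential. The scalar stays
  anonymous because only differentiability of the iterates is wanted.\<close>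

lemma iterated_vector_derivative_cis:
  "\<exists>c. ((\<lambda>g y. vector_derivative g (at y)) ^^ n) (\<lambda>x. cis (of_int k * x)) = (\<lambda>x. c * cis (of_int k * x))"
proof (induction n)
  case 0
  show ?case by (intro exI[of _ 1]) simp
next
  case (Suc n)
  then obtain c where c: "((\<lambda>g y. vector_derivative g (at y)) ^^ n) (\<lambda>x. cis (of_int k * x)) =
      (\<lambda>x. c * cis (of_int k * x))" by blast
  have "vector_derivative (\<lambda>x. c * cis (of_int k * x)) (at x) = (c * \<i> * of_int k) * cis (of_int k * x)" for x
    by (rule vector_derivative_at[OF has_vector_derivative_cis])
  then show ?case
    using c by auto
qed

lemma smooth_periodic_cis: "smooth_periodic (\<lambda>x. cis (of_int k * x))"
  unfolding smooth_periodic_def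
proof safe
  have "cis (of_int k * (x + 2 * pi)) = cis (of_int k * x)" for x
    using cis_multiple_2pi[of "of_int k"] by (simp add: ring_distribs mult_ac flip: cis_mult)
  then show "periodic (\<lambda>x. cis (of_int k * x))"
    by (simp add: periodic_def)
  fix n x
  obtain c where "((\<lambda>g y. vector_derivative g (at y)) ^^ n) (\<lambda>x. cis (of_int k * x)) =
      (\<lambda>x. c * cis (of_int k * x))"
    using iterated_vector_derivative_cis by blast
  moreover have "(\<lambda>x. c * cis (of_int k * x)) differentiable (at x)"
    by (rule differentiableI_vector[OF has_vector_derivative_cis])
  ultimately show "((\<lambda>g y. vector_derivative g (at y)) ^^ n) (\<lambda>x. cis (of_int k * x)) differentiable (at x)"
    by simp
qed

lemma frac_lap_sum_cis:
  assumes "finite A"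
  shows "frac_lap s (\<lambda>x. \<Sum>k\<in>A. c k * cis (of_int k * x)) x =
    (\<Sum>k\<in>A. of_real (\<bar>of_int k\<bar> powr (2 * s)) * c k * cis (of_int k * x))"
  unfolding frac_lap_def
  by (rule infsumI, rule has_sum_finite_neutralI[OF assms]) (auto simp: fourier_coeff_sum_cis assms)

text \<open>The exponential of frequency \<open>k\<close> is an admissible test function and an
  eigenfunction of \<open>frac_lap s\<close>, so testing with it isolates one coefficient; the
  pairing is \<open>2 * pi\<close> times that coefficient.\<close>

lemma fnls_solution_fourier_coeff:
  assumes "fnls_solution T s u\<^sub>0 u" "t \<in> {0..T}"
  shows "((\<lambda>\<tau>. fourier_coeff (u \<tau>) k) has_vector_derivative
     (- \<i> * of_real (\<bar>of_int k\<bar> powr (2 * s)) * fourier_coeff (u t) k + \<i> * fourier_coeff (cubic (u t)) k))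
     (at t within {0..T})"
proof -
  define \<phi> where "\<phi> = (\<lambda>x. cis (of_int k * x))"
  have inner: "L2_inner w \<phi> = 2 * pi * fourier_coeff w k" for w
    by (simp add: L2_inner_def \<phi>_def fourier_coeff_def cis_cnj)
  have "frac_lap s \<phi> x = of_real (\<bar>of_int k\<bar> powr (2 * s)) * \<phi> x" for x
    using frac_lap_sum_cis[of "{k}" s "\<lambda>_. 1" x] by (simp add: \<phi>_def)
  then have "L2_inner w (frac_lap s \<phi>) = (LINT x|circ. of_real (\<bar>of_int k\<bar> powr (2 * s)) * (w x * cnj (\<phi> x)))" for w
    by (simp add: L2_inner_def mult_ac)
  then have lap: "L2_inner w (frac_lap s \<phi>) = of_real (\<bar>of_int k\<bar> powr (2 * s)) * (2 * pi * fourier_coeff w k)" for w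
    using inner[of w] by (simp add: L2_inner_def)
  obtain d where d: "((\<lambda>\<tau>. L2_inner (u \<tau>) \<phi>) has_vector_derivative d) (at t within {0..T})"
    and eq: "\<i> * d - L2_inner (u t) (frac_lap s \<phi>) + L2_inner (cubic (u t)) \<phi> = 0"
    using assms smooth_periodic_cis[of k] unfolding fnls_solution_def \<phi>_def by blast
  have "d = - \<i> * (\<i> * d)" by simp
  also have "\<i> * d = of_real (\<bar>of_int k\<bar> powr (2 * s)) * (2 * pi * fourier_coeff (u t) k) - 2 * pi * fourier_coeff (cubic (u t)) k"
    using eq by (simp add: lap inner algebra_simps)
  finally have "d / (2 * pi) = - \<i> * of_real (\<bar>of_int k\<bar> powr (2 * s)) * fourier_coeff (u t) k + \<i> * fourier_coeff (cubic (u t)) k"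
    by (simp add: field_simps)
  moreover have "((\<lambda>\<tau>. L2_inner (u \<tau>) \<phi> / (2 * pi)) has_vector_derivative d / (2 * pi)) (at t within {0..T})"
    using d by (rule has_vector_derivative_divide)
  ultimately show ?thesis
    by (simp add: inner)
qed

section \<open>Discrete Fourier transform and the coefficient equations of the Galerkin
  solution\<close>

text \<open>A geometric sum whose ratio \<open>z\<close> satisfies \<open>z ^ n = 1\<close>, while
  \<open>z \<noteq> 1\<close> because \<open>n\<close> cannot divide a nonzero integer of smaller
  modulus.\<close>

lemma sum_cis_roots_of_unity:
  assumes "m \<noteq> 0" "\<bar>m\<bar> < int n"
  shows "(\<Sum>j<n. cis (of_int m * (2 * pi * real j / real n))) = 0"
proof -
  define z where "z = cis (2 * pi * of_int m / real n)"
  have n: "n > 0" using assms by auto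
  have "z ^ n = cis (2 * pi * of_int m)"
  proof -
    have "real n * (2 * pi * of_int m / real n) = 2 * pi * of_int m"
      using n by simp
    then show ?thesis by (simp only: z_def Complex.DeMoivre)
  qed
  then have zn: "z ^ n = 1" by (simp add: cis_multiple_2pi)
  have "z \<noteq> 1"
  proof
    assume "z = 1"
    then have "cos (2 * pi * of_int m / real n) = 1"
      unfolding z_def by (metis cis.sel(1) one_complex.sel(1))
    then obtain l :: int where "2 * pi * of_int m / real n = of_int l * 2 * pi"
      by (metis cos_one_2pi_int)
    then have "real_of_int m = of_int l * real n" using n by (simp add: field_simps)
    then have "m = l * int n" by (metis of_int_eq_iff of_int_mult of_int_of_nat_eq)
    with assms n show False by (cases "l = 0") (auto simp: abs_mult mult_less_cancel_right1)
  qed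
  have "(\<Sum>j<n. cis (of_int m * (2 * pi * real j / real n))) = (\<Sum>j<n. z ^ j)"
    unfolding z_def Complex.DeMoivre by (intro sum.cong refl arg_cong[of _ _ cis]) (simp add: field_simps)
  also have "\<dots> = 0"
    using \<open>z \<noteq> 1\<close> zn by (simp add: geometric_sum)
  finally show ?thesis .
qed

text \<open>With \<open>2 * N + 1\<close> nodes there is no aliasing: two frequencies of modulus at
  most \<open>N\<close> differ by at most \<open>2 * N\<close>, which is less than the number of
  nodes.\<close>

lemma discrete_fourier_inversion:
  fixes N :: nat and c :: "int \<Rightarrow> complex"
  assumes k: "k \<in> {- int N..int N}"
  defines "n \<equiv> 2 * N + 1"
  shows "(\<Sum>j<n. (\<Sum>l\<in>{- int N..int N}. c l * cis (of_int l * (2 * pi * real j / real n))) *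
      cis (- (of_int k * (2 * pi * real j / real n)))) / of_nat n = c k"
proof -
  have "(\<Sum>j<n. (\<Sum>l\<in>{- int N..int N}. c l * cis (of_int l * (2 * pi * real j / real n))) *
      cis (- (of_int k * (2 * pi * real j / real n)))) =
      (\<Sum>j<n. \<Sum>l\<in>{- int N..int N}. c l * cis (of_int (l - k) * (2 * pi * real j / real n)))"
  proof -
    have "cis (of_int l * y) * cis (- (of_int k * y)) = cis (of_int (l - k) * y)" for l y
      by (simp add: cis_mult left_diff_distrib)
    then show ?thesis
      by (simp only: sum_distrib_right mult.assoc)
  qed
  also have "\<dots> = (\<Sum>l\<in>{- int N..int N}. \<Sum>j<n. c l * cis (of_int (l - k) * (2 * pi * real j / real n)))"
    by (rule sum.swap)
  also have "\<dots> = (\<Sum>l\<in>{- int N..int N}. if l = k then c l * of_nat n else 0)"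
  proof (rule sum.cong[OF refl])
    fix l assume l: "l \<in> {- int N..int N}"
    show "(\<Sum>j<n. c l * cis (of_int (l - k) * (2 * pi * real j / real n))) = (if l = k then c l * of_nat n else 0)"
    proof (cases "l = k")
      case False
      then have "(\<Sum>j<n. cis (of_int (l - k) * (2 * pi * real j / real n))) = 0"
        using k l by (intro sum_cis_roots_of_unity) (auto simp: n_def)
      then show ?thesis using False by (simp flip: sum_distrib_left)
    qed simp
  qed
  also have "\<dots> = c k * of_nat n"
    using k by simp
  finally show ?thesis by (simp add: n_def del: of_nat_Suc of_nat_add)
qed

lemma trig_space_eq:
  assumes "f \<in> trig_space N"
  shows "f = (\<lambda>x. \<Sum>k\<in>{- int N..int N}. fourier_coeff f k * cis (of_int k * x))"
    and "k \<notin> {- int N..int N} \<Longrightarrow> fourier_coeff f k = 0"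
proof -
  obtain c where c: "f = (\<lambda>x. \<Sum>k\<in>{- int N..int N}. c k * cis (of_int k * x))"
    using assms by (auto simp: trig_space_def)
  then have coeff: "fourier_coeff f k = (if k \<in> {- int N..int N} then c k else 0)" for k
    by (simp add: fourier_coeff_sum_cis)
  then show "f = (\<lambda>x. \<Sum>k\<in>{- int N..int N}. fourier_coeff f k * cis (of_int k * x))"
    by (subst c) (auto intro!: ext sum.cong)
  show "k \<notin> {- int N..int N} \<Longrightarrow> fourier_coeff f k = 0"
    using coeff by auto
qed

lemma integrable_trig_space:
  assumes "f \<in> trig_space N"
  shows "integrable circ f"
proof -
  obtain c where c: "f = (\<lambda>x. \<Sum>k\<in>{- int N..int N}. c k * cis (of_int k * x))"
    using assms by (auto simp: trig_space_def)
  show ?thesis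
    unfolding c
  proof (rule integrable_circ_bounded[OF measurable_circ_sum_cis])
    show "norm (\<Sum>k\<in>{- int N..int N}. c k * cis (of_int k * x)) \<le> (\<Sum>k\<in>{- int N..int N}. norm (c k))" for x
      by (rule sum_norm_le) (simp add: norm_mult)
  qed
qed

text \<open>The discrete Fourier transform expresses the coefficients of a trigonometric polynomial as
  finite combinations of point values, so they inherit the pointwise time derivative.\<close>

lemma semidiscrete_solution_fourier_coeff:
  assumes v: "semidiscrete_solution T s N u\<^sub>0 v" and t: "t \<in> {0..T}" and k: "k \<in> {- int N..int N}"
  shows "((\<lambda>\<tau>. fourier_coeff (v \<tau>) k) has_vector_derivative
     (- \<i> * of_real (\<bar>of_int k\<bar> powr (2 * s)) * fourier_coeff (v t) k + \<i> * fourier_coeff (cubic (v t)) k))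
     (at t within {0..T})"
proof -
  define n where "n = 2 * N + 1"
  define p where "p j = 2 * pi * real j / real n" for j :: nat
  define dft where "dft f = (\<Sum>j<n. f (p j) * cis (- (of_int k * p j))) / of_nat n" for f :: "real \<Rightarrow> complex"
  define g where "g l = - \<i> * of_real (\<bar>of_int l\<bar> powr (2 * s)) * fourier_coeff (v t) l + \<i> * fourier_coeff (cubic (v t)) l" for l
  have trig: "v \<tau> \<in> trig_space N" if "\<tau> \<in> {0..T}" for \<tau>
    using v that by (auto simp: semidiscrete_solution_def)
  have dft: "dft (\<lambda>x. \<Sum>l\<in>{- int N..int N}. c l * cis (of_int l * x)) = c k" for c
    using discrete_fourier_inversion[OF k, of c] by (simp add: dft_def p_def n_def)
  \<comment> \<open>The right-hand side is itself a trigonometric polynomial of degree at most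
    \<open>N\<close>, so \<open>dft\<close> applied to the pointwise time derivative returns exactly
    \<open>g k\<close>.\<close>
  have "galerkin_rhs s N (v t) x = (\<Sum>l\<in>{- int N..int N}. g l * cis (of_int l * x))" for x
  proof -
    have "frac_lap s (v t) x = (\<Sum>l\<in>{- int N..int N}. of_real (\<bar>of_int l\<bar> powr (2 * s)) * fourier_coeff (v t) l * cis (of_int l * x))"
      by (subst trig_space_eq(1)[OF trig[OF t]], rule frac_lap_sum_cis) simp
    then show ?thesis
      unfolding galerkin_rhs_def trig_proj_def g_def
      by (simp only: sum_distrib_left sum.distrib[symmetric]) (intro sum.cong refl, simp add: algebra_simps)
  qed
  then have "galerkin_rhs s N (v t) = (\<lambda>x. \<Sum>l\<in>{- int N..int N}. g l * cis (of_int l * x))"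
    by (rule ext)
  then have rhs: "dft (galerkin_rhs s N (v t)) = g k"
    by (simp only: dft)
  have "((\<lambda>\<tau>. dft (v \<tau>)) has_vector_derivative dft (galerkin_rhs s N (v t))) (at t within {0..T})"
    unfolding dft_def
    using v t unfolding semidiscrete_solution_def
    by (intro has_vector_derivative_divide has_vector_derivative_sum has_vector_derivative_mult_left) auto
  moreover have "dft (v \<tau>) = fourier_coeff (v \<tau>) k" if "\<tau> \<in> {0..T}" for \<tau>
    by (rule trans[OF arg_cong[OF trig_space_eq(1)[OF trig[OF that]], of dft] dft])
  ultimately have "((\<lambda>\<tau>. fourier_coeff (v \<tau>) k) has_vector_derivative dft (galerkin_rhs s N (v t))) (at t within {0..T})"
    using t by (auto intro: has_vector_derivative_transform[where f = "\<lambda>\<tau>. dft (v \<tau>)"])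
  then show ?thesis
    by (simp add: rhs g_def)
qed

section \<open>Mass conservation and the energy estimate\<close>

lemma has_real_derivative_cmod_sq:
  fixes f :: "real \<Rightarrow> complex"
  assumes "(f has_vector_derivative f') (at t within S)"
  shows "((\<lambda>x. (cmod (f x))\<^sup>2) has_real_derivative 2 * Re (cnj (f t) * f')) (at t within S)"
proof -
  have "((\<lambda>x. f x \<bullet> f x) has_vector_derivative (f t \<bullet> f' + f' \<bullet> f t)) (at t within S)"
    by (rule bounded_bilinear.has_vector_derivative[OF bounded_bilinear_inner assms assms])
  then have "((\<lambda>x. f x \<bullet> f x) has_real_derivative (f t \<bullet> f' + f' \<bullet> f t)) (at t within S)"
    by (simp add: has_real_derivative_iff_has_vector_derivative)
  then show ?thesis
    by (simp add: power2_norm_eq_inner inner_complex_def algebra_simps)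
qed

text \<open>The derivative of the sum is the real part of the equation paired with \<open>v\<close>
  itself. The linear term gives \<open>-\<i>\<close> times a real number, and the cubic term gives
  \<open>\<i>\<close> times a multiple of the integral of \<open>cmod (v \<tau> x) ^ 4\<close>,
  again real, so both real parts vanish.\<close>

lemma semidiscrete_solution_mass:
  assumes v: "semidiscrete_solution T s N u\<^sub>0 v" and t: "t \<in> {0..T}"
  shows "(\<Sum>k\<in>{- int N..int N}. (cmod (fourier_coeff (v t) k))\<^sup>2) =
    (\<Sum>k\<in>{- int N..int N}. (cmod (fourier_coeff (v 0) k))\<^sup>2)"
proof -
  define m where "m \<tau> = (\<Sum>k\<in>{- int N..int N}. (cmod (fourier_coeff (v \<tau>) k))\<^sup>2)" for \<tau>
  have "(m has_real_derivative 0) (at \<tau> within {0..T})" if \<tau>: "\<tau> \<in> {0..T}" for \<tau>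
  proof -
    define b d where "b = fourier_coeff (v \<tau>)" and "d = fourier_coeff (cubic (v \<tau>))"
    have trig: "v \<tau> \<in> trig_space N"
      using v \<tau> by (auto simp: semidiscrete_solution_def)
    have summ: "abs_summable b"
      using trig_space_eq(2)[OF trig] unfolding b_def
      by (intro has_sum_imp_summable[OF has_sum_finite_neutralI[of "{- int N..int N}"]]) auto
    have int: "integrable circ (cubic (v \<tau>))"
    proof -
      have "v \<tau> = fourier_series b"
      proof
        fix x
        show "v \<tau> x = fourier_series b x"
          unfolding fourier_series_def b_def
          by (rule sym, rule infsumI, rule has_sum_finite_neutralI[of "{- int N..int N}"])
            (use trig_space_eq(2)[OF trig] fun_cong[OF trig_space_eq(1)[OF trig], of x] in auto)
      qed
      then show ?thesis
        using integrable_cubic_fourier_series[OF summ] by simp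
    qed
    \<comment> \<open>Only the projected cubic appears in this sum. Since \<open>v \<tau>\<close>
      has no higher frequencies, its pairing with \<open>v \<tau>\<close> is the same as that of the
      full cubic.\<close>
    have "(\<Sum>k\<in>{- int N..int N}. cnj (b k) * d k) =
        (\<Sum>k\<in>{- int N..int N}. (LINT x|circ. cnj (b k) * (cubic (v \<tau>) x * cis (- (of_int k * x))))) / (2 * pi)"
      by (simp add: d_def fourier_coeff_def sum_divide_distrib)
    also have "(\<Sum>k\<in>{- int N..int N}. (LINT x|circ. cnj (b k) * (cubic (v \<tau>) x * cis (- (of_int k * x))))) =
        (LINT x|circ. (\<Sum>k\<in>{- int N..int N}. cnj (b k) * (cubic (v \<tau>) x * cis (- (of_int k * x)))))"
    proof (rule Bochner_Integration.integral_sum[symmetric])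
      fix k
      show "integrable circ (\<lambda>x. cnj (b k) * (cubic (v \<tau>) x * cis (- (of_int k * x))))"
        using integrable_circ_mult_cis[OF int, of "- of_int k"] by (intro integrable_mult_right) simp
    qed
    also have "(\<lambda>x. \<Sum>k\<in>{- int N..int N}. cnj (b k) * (cubic (v \<tau>) x * cis (- (of_int k * x)))) =
        (\<lambda>x. complex_of_real ((cmod (v \<tau> x)) ^ 4))"
    proof
      fix x
      have "cnj (v \<tau> x) = (\<Sum>k\<in>{- int N..int N}. cnj (b k) * cis (- (of_int k * x)))"
        using arg_cong[OF fun_cong[OF trig_space_eq(1)[OF trig], of x], of cnj] by (simp add: b_def cis_cnj)
      then have "(\<Sum>k\<in>{- int N..int N}. cnj (b k) * (cubic (v \<tau>) x * cis (- (of_int k * x)))) =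
          cubic (v \<tau>) x * cnj (v \<tau> x)"
        by (simp add: sum_distrib_left mult_ac)
      also have "\<dots> = of_real ((cmod (v \<tau> x))\<^sup>2) * (v \<tau> x * cnj (v \<tau> x))"
        by (simp add: cubic_def mult_ac)
      also have "\<dots> = of_real ((cmod (v \<tau> x)) ^ 4)"
        by (simp flip: complex_norm_square of_real_mult of_real_power power_add)
      finally show "(\<Sum>k\<in>{- int N..int N}. cnj (b k) * (cubic (v \<tau>) x * cis (- (of_int k * x)))) =
          of_real ((cmod (v \<tau> x)) ^ 4)" .
    qed
    also have "(LINT x|circ. complex_of_real ((cmod (v \<tau> x)) ^ 4)) = of_real (LINT x|circ. (cmod (v \<tau> x)) ^ 4)"
      by (rule integral_complex_of_real)
    finally have im: "Im (\<Sum>k\<in>{- int N..int N}. cnj (b k) * d k) = 0"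
      by simp
    have "(m has_real_derivative (\<Sum>k\<in>{- int N..int N}.
        2 * Re (cnj (b k) * (- \<i> * of_real (\<bar>of_int k\<bar> powr (2 * s)) * b k + \<i> * d k)))) (at \<tau> within {0..T})"
      unfolding m_def b_def d_def
      by (intro DERIV_sum has_real_derivative_cmod_sq semidiscrete_solution_fourier_coeff[OF v] \<tau>)
    also have "(\<Sum>k\<in>{- int N..int N}.
        2 * Re (cnj (b k) * (- \<i> * of_real (\<bar>of_int k\<bar> powr (2 * s)) * b k + \<i> * d k))) =
        (\<Sum>k\<in>{- int N..int N}. - 2 * Im (cnj (b k) * d k))"
      by (intro sum.cong refl) (simp add: algebra_simps)
    also have "\<dots> = - 2 * Im (\<Sum>k\<in>{- int N..int N}. cnj (b k) * d k)"
      by (simp only: Im_sum sum_distrib_left)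
    finally show ?thesis using im by simp
  qed
  then have "\<exists>c. \<forall>\<tau>\<in>{0..T}. m \<tau> = c"
    by (intro has_field_derivative_zero_constant) auto
  then have "m t = m 0"
    using t by (metis atLeastAtMost_iff order.trans order_refl)
  then show ?thesis by (simp add: m_def)
qed

text \<open>A continuation argument. The bound on \<open>y'\<close> is available only while
  \<open>y \<le> 1\<close>, but as long as it is, Gronwall gives
  \<open>y + D \<le> D * exp (L * T) \<le> 1\<close>, and \<open>D > 0\<close> turns this into the
  strict \<open>y < 1\<close>. Hence there is no first time at which \<open>y\<close> reaches
  1.\<close>

lemma gronwall_while_small:
  fixes y y' :: "real \<Rightarrow> real"
  assumes deriv: "\<And>t. t \<in> {0..T} \<Longrightarrow> (y has_real_derivative y' t) (at t within {0..T})"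
    and bound: "\<And>t. t \<in> {0..T} \<Longrightarrow> y t \<le> 1 \<Longrightarrow> y' t \<le> L * (y t + D)"
    and "y 0 = 0" and "L \<ge> 0" and "D > 0" and small: "D * exp (L * T) \<le> 1"
    and t: "t \<in> {0..T}"
  shows "y t + D \<le> D * exp (L * t)" and "y t < 1"
proof -
  \<comment> \<open>The hypothesis on \<open>y\<close> concerns times strictly before
    \<open>\<tau>\<close>, so that the claim can be used at a first exit time. The mean value
    theorem evaluates the derivative only at an interior point.\<close>
  have upto: "y \<tau> + D \<le> D * exp (L * \<tau>)"
    if \<tau>: "\<tau> \<in> {0..T}" and lt: "\<And>r. 0 \<le> r \<Longrightarrow> r < \<tau> \<Longrightarrow> y r \<le> 1" for \<tau>
  proof (cases "\<tau> = 0")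
    case False
    define w where "w r = (y r + D) * exp (- L * r)" for r
    have "\<exists>r\<in>{0<..<\<tau>}. w \<tau> - w 0 = (y' r * exp (- L * r) + (y r + D) * (exp (- L * r) * - L)) * (\<tau> - 0)"
    proof (rule mvt_simple)
      show "0 < \<tau>" using \<tau> False by auto
      fix r assume r: "0 \<le> r" "r \<le> \<tau>"
      then have "(y has_real_derivative y' r) (at r within {0..\<tau>})"
        using \<tau> by (intro DERIV_subset[OF deriv]) auto
      then have "(w has_real_derivative (y' r * exp (- L * r) + (y r + D) * (exp (- L * r) * - L))) (at r within {0..\<tau>})"
        unfolding w_def by (auto intro!: derivative_eq_intros)
      then show "(w has_derivative (\<lambda>h. (y' r * exp (- L * r) + (y r + D) * (exp (- L * r) * - L)) * h)) (at r within {0..\<tau>})"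
        by (simp add: has_field_derivative_def)
    qed
    then obtain r where r: "0 < r" "r < \<tau>"
      and eq: "w \<tau> - w 0 = (y' r * exp (- L * r) + (y r + D) * (exp (- L * r) * - L)) * \<tau>"
      by auto
    have "y' r - L * (y r + D) \<le> 0"
      using bound[of r] lt[of r] r \<tau> by auto
    then have "(y' r - L * (y r + D)) * (exp (- L * r) * \<tau>) \<le> 0"
      using \<tau> by (intro mult_nonpos_nonneg mult_nonneg_nonneg) auto
    then have "w \<tau> \<le> w 0" using eq by (simp add: algebra_simps)
    then have "w \<tau> * exp (L * \<tau>) \<le> w 0 * exp (L * \<tau>)"
      by (intro mult_right_mono) auto
    then show ?thesis using \<open>y 0 = 0\<close> by (simp add: w_def mult.assoc flip: exp_add)
  qed (use \<open>y 0 = 0\<close> in simp)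
  have lt1: "y \<tau> < 1" if "\<tau> \<in> {0..T}" and "\<And>r. 0 \<le> r \<Longrightarrow> r < \<tau> \<Longrightarrow> y r \<le> 1" for \<tau>
  proof -
    have "D * exp (L * \<tau>) \<le> D * exp (L * T)"
      using \<open>D > 0\<close> \<open>L \<ge> 0\<close> that by (intro mult_left_mono) (auto intro: mult_left_mono)
    then show ?thesis using upto[OF that] small \<open>D > 0\<close> by linarith
  qed
  have all: "y r < 1" if "r \<in> {0..T}" for r
  proof (rule ccontr)
    assume "\<not> y r < 1"
    \<comment> \<open>By continuity this set is compact; its least element is the first exit time,
      where \<open>lt1\<close> yields the contradiction.\<close>
    define Z where "Z = {0..T} \<inter> y -` {1..}"
    have "continuous_on {0..T} y"
      using deriv by (rule DERIV_continuous_on)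
    then have "closed Z"
      unfolding Z_def by (intro continuous_closed_preimage) auto
    moreover have "bounded Z" "Z \<noteq> {}"
      using \<open>\<not> y r < 1\<close> that by (auto simp: Z_def intro: bounded_subset[OF bounded_closed_interval])
    ultimately obtain z where z: "z \<in> Z" "\<And>x. x \<in> Z \<Longrightarrow> z \<le> x"
      using compact_attains_inf[of Z] compact_eq_bounded_closed by blast
    have "y x \<le> 1" if "0 \<le> x" "x < z" for x
      using z that by (force simp: Z_def)
    then have "y z < 1"
      using z by (intro lt1) (auto simp: Z_def)
    then show False using z by (auto simp: Z_def)
  qed
  show "y t < 1" using all t by auto
  show "y t + D \<le> D * exp (L * t)"
    using t by (intro upto) (auto intro: less_imp_le[OF all])
qed

section \<open>Frequency truncation and the two error estimates\<close>

lemma weight_mono: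
  assumes "s \<le> \<mu>"
  shows "weight s k \<le> weight \<mu> k"
  unfolding weight_def using assms by (intro powr_mono) auto

text \<open>The source of the rate: beyond frequency \<open>N\<close> the quotient of the two
  weights is \<open>1 + k^2\<close> raised to the nonpositive power \<open>s - \<mu>\<close>, hence
  largest where \<open>k\<close> is smallest.\<close>

lemma weight_tail:
  assumes "s \<le> \<mu>" "N \<ge> 1" "k \<notin> {- int N..int N}"
  shows "weight s k \<le> real N powr (2 * (s - \<mu>)) * weight \<mu> k"
proof -
  have "(int N)\<^sup>2 \<le> k\<^sup>2"
    using assms by (intro iffD1[OF abs_le_square_iff]) auto
  then have "(real N)\<^sup>2 \<le> (of_int k)\<^sup>2"
    by (metis of_int_le_iff of_int_of_nat_eq of_int_power)
  then have N: "0 < (real N)\<^sup>2" "(real N)\<^sup>2 \<le> 1 + (of_int k)\<^sup>2"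
    using assms by auto
  have "weight s k = (1 + (of_int k)\<^sup>2) powr (s - \<mu>) * weight \<mu> k"
    by (simp add: weight_def flip: powr_add)
  also have "\<dots> \<le> ((real N)\<^sup>2) powr (s - \<mu>) * weight \<mu> k"
    using N assms by (intro mult_right_mono powr_mono2' less_imp_le[OF weight_pos]) auto
  also have "((real N)\<^sup>2) powr (s - \<mu>) = real N powr (2 * (s - \<mu>))"
    using assms by (simp add: powr_powr flip: powr_numeral)
  finally show ?thesis .
qed

lemma sobolev_seq_mono:
  assumes "s \<le> \<mu>" "sobolev_seq \<mu> a"
  shows "sobolev_seq s a" "sobolev_sq s a \<le> sobolev_sq \<mu> a"
proof -
  have le: "weight s k * (cmod (a k))\<^sup>2 \<le> weight \<mu> k * (cmod (a k))\<^sup>2" for k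
    by (intro mult_right_mono weight_mono assms) auto
  show *: "sobolev_seq s a"
    using assms(2) unfolding sobolev_seq_def
    by (rule summable_on_comparison_test) (auto intro: le weighted_nonneg)
  show "sobolev_sq s a \<le> sobolev_sq \<mu> a"
    using * assms(2) unfolding sobolev_seq_def sobolev_sq_def by (intro infsum_mono le)
qed

text \<open>Meant for the error \<open>e\<close> and the coefficients \<open>a\<close> of
  \<open>u\<close>: above \<open>N\<close> the Galerkin solution contributes nothing, so there the
  error has the modulus of \<open>a\<close> and is controlled by the stronger norm of
  \<open>u\<close>.\<close>

lemma sobolev_sq_split:
  assumes "s \<le> \<mu>" "N \<ge> 1" and a: "sobolev_seq \<mu> a"
    and e: "\<And>k. k \<notin> {- int N..int N} \<Longrightarrow> cmod (e k) = cmod (a k)"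
  shows "sobolev_sq s e \<le> (\<Sum>k\<in>{- int N..int N}. weight s k * (cmod (e k))\<^sup>2) +
    real N powr (2 * (s - \<mu>)) * sobolev_sq \<mu> a"
proof -
  let ?f = "\<lambda>k. if k \<in> {- int N..int N} then weight s k * (cmod (e k))\<^sup>2 else 0"
  let ?g = "\<lambda>k. real N powr (2 * (s - \<mu>)) * (weight \<mu> k * (cmod (a k))\<^sup>2)"
  have f: "(?f has_sum (\<Sum>k\<in>{- int N..int N}. weight s k * (cmod (e k))\<^sup>2)) UNIV"
    by (intro has_sum_finite_neutralI[of "{- int N..int N}"]) auto
  have g: "(?g has_sum (real N powr (2 * (s - \<mu>)) * sobolev_sq \<mu> a)) UNIV"
    using a unfolding sobolev_seq_def sobolev_sq_def by (intro has_sum_cmult_right has_sum_infsum)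
  note fg = has_sum_add[OF f g]
  have le: "weight s k * (cmod (e k))\<^sup>2 \<le> ?f k + ?g k" for k
  proof (cases "k \<in> {- int N..int N}")
    case True
    then show ?thesis using weighted_nonneg[of \<mu> k "a k"] by auto
  next
    case False
    then show ?thesis
      using mult_right_mono[OF weight_tail[OF assms(1,2) False], of "(cmod (a k))\<^sup>2"] e[OF False] False
      by (auto simp: mult.assoc)
  qed
  have "(\<lambda>k. weight s k * (cmod (e k))\<^sup>2) summable_on UNIV"
    by (rule summable_on_comparison_test[OF has_sum_imp_summable[OF fg]]) (rule le, rule weighted_nonneg)
  then show ?thesis
    unfolding sobolev_sq_def[of s e] by (intro has_sum_mono[OF has_sum_infsum fg] le)
qed

text \<open>Guarantees that the low-frequency error starts at exactly zero. The values
  \<open>u 0\<close> match the initial datum only almost everywhere, which the coefficients do not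
  notice.\<close>

lemma fourier_coeff_initial:
  assumes u: "fnls_solution T s u\<^sub>0 u" "u 0 \<in> borel_measurable circ" and u0: "smooth_periodic u\<^sub>0"
    and v: "semidiscrete_solution T s N u\<^sub>0 v" and k: "k \<in> {- int N..int N}"
  shows "fourier_coeff (v 0) k = fourier_coeff (u 0) k"
proof -
  have "u\<^sub>0 differentiable (at x)" for x
    using u0 unfolding smooth_periodic_def by (metis funpow_0)
  then have "continuous_on UNIV u\<^sub>0"
    by (simp add: continuous_at_imp_continuous_on differentiable_imp_continuous_within)
  then have "u\<^sub>0 \<in> borel_measurable circ"
    by (rule measurable_circ_continuous)
  then have "fourier_coeff (u 0) k = fourier_coeff u\<^sub>0 k"
    using u unfolding fnls_solution_def by (intro fourier_coeff_cong_AE) auto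
  moreover have "v 0 = (\<lambda>x. \<Sum>k\<in>{- int N..int N}. fourier_coeff u\<^sub>0 k * cis (of_int k * x))"
    using v by (auto simp: semidiscrete_solution_def trig_proj_def)
  ultimately show ?thesis
    using k by (simp add: fourier_coeff_sum_cis)
qed

text \<open>The constants come from the stage \<open>y \<le> 1\<close>. There the squared error is
  at most \<open>1 + D \<le> 2 * Q\<close>, so the squared norm \<open>B\<close> of \<open>v\<close>
  is at most \<open>2 * (2 * Q) + 2 * Q = 6 * Q\<close>. Then
  \<open>B\<^sup>2 + A * B + A\<^sup>2\<close> is at most \<open>(36 + 6 + 1) * Q\<^sup>2\<close>,
  and \<open>4 * 43 = 172\<close>. The 1 in \<open>L\<close> is the share of \<open>y\<close> itself
  after splitting the product of error and cubic difference.\<close>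

lemma galerkin_error_small_step:
  assumes s: "1 / 2 < s" "s \<le> 1" "s < \<mu>" and u0: "smooth_periodic u\<^sub>0"
    and u: "fnls_solution T s u\<^sub>0 u" "\<And>t. t \<in> {0..T} \<Longrightarrow> u t \<in> sobolev_space \<mu>"
    and Q: "Q \<ge> 1" "\<And>t. t \<in> {0..T} \<Longrightarrow> sobolev_sq \<mu> (fourier_coeff (u t)) \<le> Q"
    and N: "N \<ge> 1" and v: "semidiscrete_solution T s N u\<^sub>0 v" and t: "t \<in> {0..T}"
  defines "D \<equiv> real N powr (2 * (s - \<mu>)) * Q" and "L \<equiv> 1 + 172 * (sobolev_const s)\<^sup>2 * Q\<^sup>2"
  assumes small: "D * exp (L * T) \<le> 1"
  shows "sobolev_sq s (\<lambda>k. fourier_coeff (v t) k - fourier_coeff (u t) k) \<le> D * exp (L * T)"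
proof -
  define I where "I = {- int N..int N}"
  define a where "a \<tau> = fourier_coeff (u \<tau>)" for \<tau>
  define b where "b \<tau> = fourier_coeff (v \<tau>)" for \<tau>
  define e where "e \<tau> = (\<lambda>k. b \<tau> k - a \<tau> k)" for \<tau>
  define d where "d \<tau> = (\<lambda>k. fourier_coeff (cubic (v \<tau>)) k - fourier_coeff (cubic (u \<tau>)) k)" for \<tau>
  define y where "y \<tau> = (\<Sum>k\<in>I. weight s k * (cmod (e \<tau> k))\<^sup>2)" for \<tau>
  define y' where "y' \<tau> = (\<Sum>k\<in>I. weight s k * (2 * Re (cnj (e \<tau> k) *
      (- \<i> * of_real (\<bar>of_int k\<bar> powr (2 * s)) * e \<tau> k + \<i> * d \<tau> k))))" for \<tau>
  have trig: "v \<tau> \<in> trig_space N" if "\<tau> \<in> {0..T}" for \<tau>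
    using v that by (auto simp: semidiscrete_solution_def)
  have b0: "b \<tau> k = 0" if "\<tau> \<in> {0..T}" "k \<notin> I" for \<tau> k
    using trig_space_eq(2)[OF trig[OF that(1)]] that(2) by (simp add: b_def I_def)
  have a\<mu>: "sobolev_seq \<mu> (a \<tau>)" if "\<tau> \<in> {0..T}" for \<tau>
    using u(2)[OF that] by (simp add: a_def sobolev_space_iff)
  have as: "sobolev_seq s (a \<tau>)" "sobolev_sq s (a \<tau>) \<le> Q" if "\<tau> \<in> {0..T}" for \<tau>
    using sobolev_seq_mono[OF less_imp_le[OF s(3)] a\<mu>[OF that]] Q(2)[OF that] by (auto simp: a_def)
  have bs: "sobolev_seq s (b \<tau>)" if "\<tau> \<in> {0..T}" for \<tau>
    using b0[OF that] by (intro sobolev_seq_finite_support(1)[of I]) (auto simp: I_def)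
  have D: "0 < D" "D \<le> Q"
  proof -
    have "real N powr (2 * (s - \<mu>)) \<le> real N powr 0"
      using N s by (intro powr_mono) auto
    then show "0 < D" "D \<le> Q" using N Q(1) by (auto simp: D_def)
  qed
  have split: "sobolev_sq s (e \<tau>) \<le> y \<tau> + D" if "\<tau> \<in> {0..T}" for \<tau>
  proof -
    have "sobolev_sq s (e \<tau>) \<le> y \<tau> + real N powr (2 * (s - \<mu>)) * sobolev_sq \<mu> (a \<tau>)"
      unfolding y_def I_def using s N a\<mu>[OF that] b0[OF that]
      by (intro sobolev_sq_split) (auto simp: e_def I_def)
    also have "\<dots> \<le> y \<tau> + D"
      unfolding D_def a_def by (intro add_left_mono mult_left_mono Q(2) that) auto
    finally show ?thesis .
  qed
  have "y t + D \<le> D * exp (L * t)"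
  proof (rule gronwall_while_small(1)[OF _ _ _ _ D(1) small t])
    show "y 0 = 0"
    proof -
      have "0 \<in> {0..T}" using t by auto
      then have "u 0 \<in> borel_measurable circ"
        using u(2) by (auto simp: sobolev_space_def L2_per_def)
      then have "b 0 k = a 0 k" if "k \<in> I" for k
        using fourier_coeff_initial[OF u(1) _ u0 v] that by (auto simp: a_def b_def I_def)
      then show ?thesis by (simp add: y_def e_def)
    qed
    show "0 \<le> L" by (simp add: L_def)
    fix \<tau> assume \<tau>: "\<tau> \<in> {0..T}"
    \<comment> \<open>For these \<open>k\<close> the projection is invisible, and the two
      coefficient equations are subtracted directly.\<close>
    have "((\<lambda>\<tau>. e \<tau> k) has_vector_derivative
        (- \<i> * of_real (\<bar>of_int k\<bar> powr (2 * s)) * e \<tau> k + \<i> * d \<tau> k)) (at \<tau> within {0..T})" if "k \<in> I" for k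
      using has_vector_derivative_diff[OF semidiscrete_solution_fourier_coeff[OF v \<tau>, of k]
          fnls_solution_fourier_coeff[OF u(1) \<tau>, of k]] that
      by (simp add: e_def d_def a_def b_def I_def algebra_simps)
    then show "(y has_real_derivative y' \<tau>) (at \<tau> within {0..T})"
      unfolding y_def[abs_def] y'_def
      by (intro DERIV_sum DERIV_cmult has_real_derivative_cmod_sq) auto
    assume y1: "y \<tau> \<le> 1"
    define A B F where "A = sobolev_sq s (a \<tau>)" and "B = sobolev_sq s (b \<tau>)" and "F = sobolev_sq s (e \<tau>)"
    have F: "0 \<le> F" "F \<le> y \<tau> + D" "F \<le> 2 * Q"
      using split[OF \<tau>] y1 D Q(1) by (auto simp: F_def sobolev_sq_nonneg)
    have es: "sobolev_seq s (e \<tau>)"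
      by (rule sobolev_seq_add_sq(1)[OF bs[OF \<tau>] as(1)[OF \<tau>]]) (simp add: e_def norm_triangle_ineq4)
    have "cmod (b \<tau> k) \<le> cmod (e \<tau> k) + cmod (a \<tau> k)" for k
      using norm_triangle_ineq[of "e \<tau> k" "a \<tau> k"] by (simp add: e_def)
    then have "B \<le> 2 * F + 2 * A"
      unfolding A_def B_def F_def by (rule sobolev_seq_add_sq(2)[OF es as(1)[OF \<tau>]])
    moreover have A: "0 \<le> A" "A \<le> Q"
      using as(2)[OF \<tau>] by (auto simp: A_def sobolev_sq_nonneg)
    ultimately have B: "0 \<le> B" "B \<le> 6 * Q"
      using F by (auto simp: B_def sobolev_sq_nonneg)
    have "B\<^sup>2 + A * B + A\<^sup>2 \<le> (6 * Q)\<^sup>2 + Q * (6 * Q) + Q\<^sup>2"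
      using A B by (intro add_mono mult_mono power_mono) auto
    then have BA: "B\<^sup>2 + A * B + A\<^sup>2 \<le> 43 * Q\<^sup>2"
      by (simp add: power2_eq_square)
    have ds: "sobolev_seq s (d \<tau>)"
      and "sobolev_sq s (d \<tau>) \<le> 4 * (sobolev_const s)\<^sup>2 * (B\<^sup>2 + A * B + A\<^sup>2) * F"
      using sobolev_sq_cubic_diff[OF s(1,2) _ as(1)[OF \<tau>, unfolded a_def] integrable_trig_space[OF trig[OF \<tau>]]
          bs[OF \<tau>, unfolded b_def]] L2_per_integrable[of "u \<tau>"] u(2)[OF \<tau>]
      by (auto simp: sobolev_space_def d_def A_def B_def F_def e_def a_def b_def)
    note this(2)
    also have "4 * (sobolev_const s)\<^sup>2 * (B\<^sup>2 + A * B + A\<^sup>2) * F \<le>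
        4 * (sobolev_const s)\<^sup>2 * (43 * Q\<^sup>2) * (y \<tau> + D)"
      using F BA A B by (intro mult_mono mult_left_mono mult_nonneg_nonneg add_nonneg_nonneg) auto
    finally have d_le: "sobolev_sq s (d \<tau>) \<le> 172 * (sobolev_const s)\<^sup>2 * Q\<^sup>2 * (y \<tau> + D)"
      by simp
    \<comment> \<open>The symbol \<open>r\<close> is unbounded in \<open>k\<close> but disappears,
      because \<open>cnj z * z\<close> is real. This makes the estimate uniform in
      \<open>N\<close>.\<close>
    have pt: "2 * Re (cnj z * (- \<i> * of_real r * z + \<i> * w)) \<le> (cmod z)\<^sup>2 + (cmod w)\<^sup>2" for z w r
    proof -
      have "Re (cnj z * (- \<i> * of_real r * z + \<i> * w)) = Re (cnj z * (\<i> * w))"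
        by (simp add: algebra_simps)
      also have "\<dots> \<le> cmod z * cmod w"
        using complex_Re_le_cmod[of "cnj z * (\<i> * w)"] by (simp add: norm_mult)
      finally show ?thesis
        using zero_le_power2[of "cmod z - cmod w"] by (simp add: power2_diff)
    qed
    have "y' \<tau> \<le> (\<Sum>k\<in>I. weight s k * ((cmod (e \<tau> k))\<^sup>2 + (cmod (d \<tau> k))\<^sup>2))"
      unfolding y'_def by (intro sum_mono mult_left_mono pt less_imp_le[OF weight_pos])
    also have "\<dots> = y \<tau> + (\<Sum>k\<in>I. weight s k * (cmod (d \<tau> k))\<^sup>2)"
      by (simp add: y_def ring_distribs sum.distrib)
    also have "(\<Sum>k\<in>I. weight s k * (cmod (d \<tau> k))\<^sup>2) \<le> sobolev_sq s (d \<tau>)"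
      using ds unfolding sobolev_seq_def sobolev_sq_def
      by (intro finite_sum_le_infsum weighted_nonneg) (auto simp: I_def)
    finally show "y' \<tau> \<le> L * (y \<tau> + D)"
      using d_le D(1) by (simp add: L_def ring_distribs)
  qed
  also have "\<dots> \<le> D * exp (L * T)"
    using D(1) t by (intro mult_left_mono) (auto simp: L_def intro: mult_left_mono)
  finally show ?thesis
    using split[OF t] by (simp add: e_def a_def b_def)
qed

text \<open>Mass conservation bounds the unweighted sum of squares of \<open>v\<close>, and an
  inverse inequality raises it to order \<open>s\<close> at the price of the largest weight up to
  frequency \<open>N\<close>. The bound grows with \<open>N\<close>, so it is meant for a bounded
  range of \<open>N\<close>.\<close>

lemma galerkin_error_crude:
  assumes s: "0 \<le> s" "s < \<mu>" and u0: "smooth_periodic u\<^sub>0"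
    and u: "fnls_solution T s u\<^sub>0 u" "\<And>t. t \<in> {0..T} \<Longrightarrow> u t \<in> sobolev_space \<mu>"
    and Q: "\<And>t. t \<in> {0..T} \<Longrightarrow> sobolev_sq \<mu> (fourier_coeff (u t)) \<le> Q"
    and v: "semidiscrete_solution T s N u\<^sub>0 v" and t: "t \<in> {0..T}"
  shows "sobolev_sq s (\<lambda>k. fourier_coeff (v t) k - fourier_coeff (u t) k) \<le>
    2 * ((1 + (real N)\<^sup>2) powr s * Q) + 2 * Q"
proof -
  define I where "I = {- int N..int N}"
  have trig: "v \<tau> \<in> trig_space N" if "\<tau> \<in> {0..T}" for \<tau>
    using v that by (auto simp: semidiscrete_solution_def)
  have supp: "fourier_coeff (v t) k = 0" if "k \<notin> I" for k
    using trig_space_eq(2)[OF trig[OF t]] that by (simp add: I_def)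
  note bs = sobolev_seq_finite_support[of I "fourier_coeff (v t)", OF _ supp]
  have zero: "0 \<in> {0..T}" using t by auto
  have seq0: "sobolev_seq \<mu> (fourier_coeff (u 0))" and meas0: "u 0 \<in> borel_measurable circ"
    using u(2)[OF zero] by (auto simp: sobolev_space_iff L2_per_def)
  have weight_le: "weight s k \<le> (1 + (real N)\<^sup>2) powr s" if "k \<in> I" for k
  proof -
    have "k\<^sup>2 \<le> (int N)\<^sup>2"
      using that by (intro iffD1[OF abs_le_square_iff]) (auto simp: I_def)
    then have "(of_int k)\<^sup>2 \<le> (real N)\<^sup>2"
      by (metis of_int_le_iff of_int_of_nat_eq of_int_power)
    then show ?thesis
      unfolding weight_def using s(1) by (intro powr_mono2) auto
  qed
  have "(\<Sum>k\<in>I. (cmod (fourier_coeff (v t) k))\<^sup>2) = (\<Sum>k\<in>I. (cmod (fourier_coeff (u 0) k))\<^sup>2)"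
    using semidiscrete_solution_mass[OF v t] fourier_coeff_initial[OF u(1) meas0 u0 v] by (simp add: I_def)
  also have "\<dots> \<le> (\<Sum>k\<in>I. weight \<mu> k * (cmod (fourier_coeff (u 0) k))\<^sup>2)"
  proof (rule sum_mono)
    fix k
    show "(cmod (fourier_coeff (u 0) k))\<^sup>2 \<le> weight \<mu> k * (cmod (fourier_coeff (u 0) k))\<^sup>2"
      using mult_right_mono[OF weight_ge_1[of \<mu> k], of "(cmod (fourier_coeff (u 0) k))\<^sup>2"] s by simp
  qed
  also have "\<dots> \<le> sobolev_sq \<mu> (fourier_coeff (u 0))"
    using seq0 unfolding sobolev_seq_def sobolev_sq_def
    by (intro finite_sum_le_infsum weighted_nonneg) (auto simp: I_def)
  also have "\<dots> \<le> Q" by (rule Q[OF zero])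
  finally have mass: "(\<Sum>k\<in>I. (cmod (fourier_coeff (v t) k))\<^sup>2) \<le> Q" .
  have "sobolev_sq s (fourier_coeff (v t)) = (\<Sum>k\<in>I. weight s k * (cmod (fourier_coeff (v t) k))\<^sup>2)"
    by (rule bs(2)) (simp add: I_def)
  also have "\<dots> \<le> (\<Sum>k\<in>I. (1 + (real N)\<^sup>2) powr s * (cmod (fourier_coeff (v t) k))\<^sup>2)"
    by (intro sum_mono mult_right_mono weight_le) auto
  also have "\<dots> \<le> (1 + (real N)\<^sup>2) powr s * Q"
    unfolding sum_distrib_left[symmetric] by (intro mult_left_mono mass) auto
  finally have v_le: "sobolev_sq s (fourier_coeff (v t)) \<le> (1 + (real N)\<^sup>2) powr s * Q" .
  have u_seq: "sobolev_seq s (fourier_coeff (u t))" "sobolev_sq s (fourier_coeff (u t)) \<le> Q"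
    using sobolev_seq_mono[of s \<mu> "fourier_coeff (u t)"] s u(2)[OF t] Q[OF t]
    by (auto simp: sobolev_space_iff)
  have "sobolev_sq s (\<lambda>k. fourier_coeff (v t) k - fourier_coeff (u t) k) \<le>
      2 * sobolev_sq s (fourier_coeff (v t)) + 2 * sobolev_sq s (fourier_coeff (u t))"
    by (rule sobolev_seq_add_sq(2)[OF bs(1) u_seq(1)]) (auto simp: I_def norm_triangle_ineq4)
  then show ?thesis
    using v_le u_seq(2) by linarith
qed

section \<open>Convergence rate from the large and the small values of the truncation
  parameter\<close>

theorem theorem2p1:
  fixes T s \<mu> :: real and u\<^sub>0 :: "real \<Rightarrow> complex" and u :: "real \<Rightarrow> real \<Rightarrow> complex"
  assumes "T > 0" and "1 / 2 < s" and "s \<le> 1" and "\<mu> > s"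
    and "smooth_periodic u\<^sub>0"
    and "fnls_solution T s u\<^sub>0 u"
    and "\<forall>t\<in>{0..T}. u t \<in> sobolev_space \<mu>"
    and "bdd_above ((\<lambda>t. sobolev_norm \<mu> (u t)) ` {0..T})"
  shows "\<exists>C::real. \<forall>N::nat\<ge>1. \<forall>v::real \<Rightarrow> real \<Rightarrow> complex.
    semidiscrete_solution T s N u\<^sub>0 v \<longrightarrow>
    1 - (C_infty s)\<^sup>2 * mass (v 0) > 0 \<longrightarrow>
    mass (v 0) / 2 + hamiltonian s (v 0) \<ge> 0 \<longrightarrow>
    (\<forall>t\<in>{0..T}. sobolev_norm s (\<lambda>x. v t x - u t x) \<le> C * real N powr (s - \<mu>))"
proof -
  obtain M where M: "\<And>t. t \<in> {0..T} \<Longrightarrow> sobolev_norm \<mu> (u t) \<le> M"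
    using assms(8) unfolding bdd_above_def by blast
  \<comment> \<open>The lower bound 1 lets multiples of \<open>Q\<close> absorb the threshold in
    \<open>y \<le> 1\<close>.\<close>
  define Q where "Q = max 1 (M\<^sup>2)"
  have Q: "Q \<ge> 1" by (simp add: Q_def)
  have uQ: "sobolev_sq \<mu> (fourier_coeff (u t)) \<le> Q" if "t \<in> {0..T}" for t
    using sqrt_le_D[OF M[OF that, unfolded sobolev_norm_eq]] by (simp add: Q_def)
  define L where "L = 1 + 172 * (sobolev_const s)\<^sup>2 * Q\<^sup>2"
  define R where "R = Q * exp (L * T)"
  have R: "R \<ge> 1"
  proof -
    have "1 * 1 \<le> Q * exp (L * T)"
      using \<open>T > 0\<close> Q by (intro mult_mono) (auto simp: L_def)
    then show ?thesis by (simp add: R_def)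
  qed
  \<comment> \<open>Solves \<open>R * N0 powr (2 * (s - \<mu>)) = 1\<close>: the smallness condition
    can fail only for \<open>N\<close> up to this threshold, which depends on neither
    \<open>N\<close> nor \<open>v\<close>.\<close>
  define N0 where "N0 = R powr (1 / (2 * (\<mu> - s)))"
  \<comment> \<open>One summand per case. The second has the extra factor \<open>R\<close> because
    in that case \<open>R * real N powr (2 * (s - \<mu>))\<close> exceeds 1, which converts a
    constant bound into the desired rate.\<close>
  define K where "K = R + (2 * ((1 + N0\<^sup>2) powr s * Q) + 2 * Q) * R"
  have K: "K \<ge> R" "K \<ge> (2 * ((1 + N0\<^sup>2) powr s * Q) + 2 * Q) * R"
    using Q R by (auto simp: K_def intro!: mult_nonneg_nonneg add_nonneg_nonneg)
  have main: "sobolev_sq s (\<lambda>k. fourier_coeff (v t) k - fourier_coeff (u t) k) \<le> K * real N powr (2 * (s - \<mu>))"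
    if N: "N \<ge> 1" and v: "semidiscrete_solution T s N u\<^sub>0 v" and t: "t \<in> {0..T}" for N v t
  proof (cases "R * real N powr (2 * (s - \<mu>)) \<le> 1")
    case True
    have "sobolev_sq s (\<lambda>k. fourier_coeff (v t) k - fourier_coeff (u t) k) \<le>
        real N powr (2 * (s - \<mu>)) * Q * exp (L * T)"
      unfolding L_def
      using True assms(7) by (intro galerkin_error_small_step[OF assms(2,3,4,5,6) _ Q uQ N v t])
        (auto simp: R_def L_def mult_ac)
    also have "\<dots> = R * real N powr (2 * (s - \<mu>))"
      by (simp add: R_def)
    also have "\<dots> \<le> K * real N powr (2 * (s - \<mu>))"
      using K(1) by (intro mult_right_mono) auto
    finally show ?thesis .
  next
    case False
    then have gt: "1 < R * real N powr (2 * (s - \<mu>))" by simp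
    have "real N powr (2 * (\<mu> - s)) * 1 \<le> real N powr (2 * (\<mu> - s)) * (R * real N powr (2 * (s - \<mu>)))"
      using gt by (intro mult_left_mono) auto
    also have "\<dots> = R * real N powr (2 * (\<mu> - s) + 2 * (s - \<mu>))"
      by (simp only: powr_add mult_ac)
    also have "\<dots> = R" using N by simp
    finally have "(real N powr (2 * (\<mu> - s))) powr (1 / (2 * (\<mu> - s))) \<le> N0"
      unfolding N0_def using assms(4) by (intro powr_mono2) auto
    then have N0: "real N \<le> N0"
      using assms(4) N by (simp add: powr_powr)
    have "sobolev_sq s (\<lambda>k. fourier_coeff (v t) k - fourier_coeff (u t) k) \<le>
        2 * ((1 + (real N)\<^sup>2) powr s * Q) + 2 * Q"
      using assms(2,7) by (intro galerkin_error_crude[OF _ assms(4,5,6) _ uQ v t]) auto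
    also have "\<dots> \<le> 2 * ((1 + N0\<^sup>2) powr s * Q) + 2 * Q"
      using N0 Q assms(2) by (intro add_mono mult_left_mono mult_right_mono powr_mono2 power_mono) auto
    also have "\<dots> * 1 \<le> (2 * ((1 + N0\<^sup>2) powr s * Q) + 2 * Q) * (R * real N powr (2 * (s - \<mu>)))"
      using gt Q by (intro mult_left_mono) auto
    also have "\<dots> \<le> K * real N powr (2 * (s - \<mu>))"
      using mult_right_mono[OF K(2), of "real N powr (2 * (s - \<mu>))"] by (simp only: mult.assoc powr_ge_zero)
    finally show ?thesis by simp
  qed
  have "sobolev_norm s (\<lambda>x. v t x - u t x) \<le> sqrt K * real N powr (s - \<mu>)"
    if N: "N \<ge> 1" and v: "semidiscrete_solution T s N u\<^sub>0 v" and t: "t \<in> {0..T}" for N v t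
  proof -
    have "integrable circ (u t)" "integrable circ (v t)"
      using assms(7) v t by (auto simp: sobolev_space_def semidiscrete_solution_def
          intro: L2_per_integrable integrable_trig_space)
    then have "fourier_coeff (\<lambda>x. v t x - u t x) = (\<lambda>k. fourier_coeff (v t) k - fourier_coeff (u t) k)"
      by (simp add: fourier_coeff_diff fun_eq_iff)
    then have "sobolev_norm s (\<lambda>x. v t x - u t x) \<le> sqrt (K * real N powr (2 * (s - \<mu>)))"
      unfolding sobolev_norm_eq using main[OF that] by simp
    also have "real N powr (2 * (s - \<mu>)) = (real N powr (s - \<mu>))\<^sup>2"
      using N by (simp add: powr_powr mult.commute flip: powr_numeral)
    finally show ?thesis by (simp add: real_sqrt_mult)
  qed
  then show ?thesis by blast
qed

end
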